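(* Let $M$ be a totally ordered, integrally terminal, positive, bounded factorization monoid. Suppose that $\Gamma := \mathsf{gp}(M)$ has no minimal strictly positive element. Further suppose that there exist some $\alpha \in M$ such that $M$ is integrally terminal for $\alpha$ and some $\beta \in \Gamma$ with $0 < \beta < \alpha$ such that no $\gamma \in M$ satisfies $\beta < \gamma < \alpha$. Let $k$ be a field and suppose that $k$ is not algebraically closed or $\Gamma$ is not divisible. Let $D = k[t;M]_{(t;M)}$, let $K$ be its field of fractions, and let $v$ be the $M$-valuation on $K$. Then for any nonzero, nonunit $d \in D$ with $v(d) > 3\alpha$, we have $$\mathcal{L}_D(d) \cup \{2, \dots, N-2\} \subseteq \mathcal{L}_{\operatorname{Int}^{\mathrm R}(K,D)}(d) \subseteq \{2, \dots, L_D(d)\},$$ where $N := \min\{n \in \mathbb{N} \mid n\alpha > v(d)\}$.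
   Context: Rings are commutative with identity; monoids are commutative, cancellative and written additively here. For a domain $D$ with field of fractions $K$, $\operatorname{Int}^{\mathrm R}(K,D) = \{\varphi \in K(x) \mid \varphi(a) \in D \text{ for all } a \in K\}$; elements of $D$ are viewed in it as constant functions. For a domain (or monoid) $R$ and a nonzero nonunit $r \in R$, $\mathcal{L}_R(r)$ is the set of lengths of factorizations of $r$ in $R$, i.e. the set of all $n$ such that $r$ is (up to a unit) a product of $n$ atoms (irreducible elements) of $R$, counted with multiplicity; $L_R(r)=\sup\mathcal{L}_R(r)$. $R$ is atomic if every nonzero nonunit is a finite product of atoms, and of bounded factorization if it is atomic and all sets $\mathcal{L}_R(r)$ are finite (for an additive monoid, sums replace products). A monoid $M$ is totally ordered if it carries a total order $\le$ such that $\alpha\le\alpha'$ and $\beta\le\beta'$ imply $\alpha+\beta\le\alpha'+\beta'$. It is positive if $\alpha\ge 0$ for all $\alpha\in M$. Its difference group is $\mathsf{gp}(M)=\{\alpha-\alpha'\mid \alpha,\alpha'\in M\}$, with the induced total order. $M$ is integrally terminal for $\gamma\in\mathsf{gp}(M)$ if every $\gamma'\in\mathsf{gp}(M)$ with $\gamma'>\gamma$ lies in $M$, and for each $\gamma'\in\mathsf{gp}(M)$ with $\gamma'>0$ there is $n\in\mathbb{N}$ with $n\gamma'>\gamma$. $M$ is integrally terminal if it is integrally terminal for some $\gamma\in\mathsf{gp}(M)$. $k[t;M]$ is the monoid ring, whose elements are finite sums of terms $r t^\alpha$ ($r\in k$, $\alpha\in M$) with $t^{\alpha}t^{\beta}=t^{\alpha+\beta}$.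 $(t;M)$ is the ideal generated by $\{t^\alpha\mid \alpha \text{ a nonzero nonunit of } M\}$, and $k[t;M]_{(t;M)}$ is the localization at this prime ideal. The $M$-valuation $v$ is defined on $k[t;M]$ by sending a sum $\sum_i a_i t^{\alpha_i}$, with distinct $\alpha_i \in M$ and nonzero $a_i \in k$, to $\min_i \alpha_i$; it extends uniquely to a valuation on $K$ with value group $\mathsf{gp}(M)$. *)

theory Defs
  imports
    "HOL-Library.Poly_Mapping"
    "HOL-Library.Extended_Nat"
    "HOL-Computational_Algebra.Polynomial"
    "HOL-Computational_Algebra.Fraction_Field"
    "HOL-Algebra.Divisibility"
    "HOL-Algebra.Ideal"
begin

text \<open>A totally ordered cancellative commutative monoid is represented as a submonoid \<open>M\<close> of a
  linearly ordered abelian group, namely of its difference group: the requirement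
  \<open>gp M = UNIV\<close> says that the ambient type is exactly that group.\<close>

section \<open>Factorizations\<close>

text \<open>Both kinds of objects are treated through a monoid record: an additive monoid \<open>M\<close> through
  \<open>add_monoid_of M\<close>, and a domain \<open>R\<close> (a subring of a field) through the multiplicative monoid
  \<open>mult_monoid_of R\<close> of its nonzero elements.\<close>

definition add_monoid_of :: "'a::monoid_add set \<Rightarrow> 'a monoid" where
  "add_monoid_of M = \<lparr>carrier = M, mult = (+), one = 0\<rparr>"

definition mult_monoid_of :: "'a::{monoid_mult,zero} set \<Rightarrow> 'a monoid" where
  "mult_monoid_of R = \<lparr>carrier = R - {0}, mult = (*), one = 1\<rparr>"

definition lengths :: "('a, 'b) monoid_scheme \<Rightarrow> 'a \<Rightarrow> nat set" where
  "lengths G r = {length fs | fs. set fs \<subseteq> carrier G \<and> wfactors G fs r}"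

definition max_length :: "('a, 'b) monoid_scheme \<Rightarrow> 'a \<Rightarrow> enat" where
  "max_length G r = (SUP n\<in>lengths G r. enat n)"

definition atomic :: "('a, 'b) monoid_scheme \<Rightarrow> bool" where
  "atomic G \<longleftrightarrow>
    (\<forall>r\<in>carrier G - Units G. \<exists>fs. set fs \<subseteq> carrier G \<and> factors G fs r)"

definition bounded_factorization :: "('a, 'b) monoid_scheme \<Rightarrow> bool" where
  "bounded_factorization G \<longleftrightarrow>
    atomic G \<and> (\<forall>r\<in>carrier G - Units G. finite (lengths G r))"

section \<open>Totally ordered monoids\<close>

definition nmult :: "nat \<Rightarrow> 'a::comm_monoid_add \<Rightarrow> 'a" where
  "nmult n \<gamma> = (\<Sum>i<n. \<gamma>)"

definition is_submonoid :: "'g::monoid_add set \<Rightarrow> bool" where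
  "is_submonoid M \<longleftrightarrow> 0 \<in> M \<and> (\<forall>\<alpha>\<in>M. \<forall>\<alpha>'\<in>M. \<alpha> + \<alpha>' \<in> M)"

definition gp :: "'g::ab_group_add set \<Rightarrow> 'g set" where
  "gp M = {\<alpha> - \<alpha>' | \<alpha> \<alpha>'. \<alpha> \<in> M \<and> \<alpha>' \<in> M}"

definition positive :: "'g::linordered_ab_group_add set \<Rightarrow> bool" where
  "positive M \<longleftrightarrow> (\<forall>\<alpha>\<in>M. 0 \<le> \<alpha>)"

definition integrally_terminal_for :: "'g::linordered_ab_group_add set \<Rightarrow> 'g \<Rightarrow> bool" where
  "integrally_terminal_for M \<gamma> \<longleftrightarrow> \<gamma> \<in> gp M \<and>
     (\<forall>\<gamma>'\<in>gp M. \<gamma> < \<gamma>' \<longrightarrow> \<gamma>' \<in> M) \<and>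
     (\<forall>\<gamma>'\<in>gp M. 0 < \<gamma>' \<longrightarrow> (\<exists>n. \<gamma> < nmult n \<gamma>'))"

definition integrally_terminal :: "'g::linordered_ab_group_add set \<Rightarrow> bool" where
  "integrally_terminal M \<longleftrightarrow> (\<exists>\<gamma>\<in>gp M. integrally_terminal_for M \<gamma>)"

definition divisible_group :: "'g::ab_group_add set \<Rightarrow> bool" where
  "divisible_group \<Gamma> \<longleftrightarrow> (\<forall>\<gamma>\<in>\<Gamma>. \<forall>n\<ge>1. \<exists>\<delta>\<in>\<Gamma>. nmult n \<delta> = \<gamma>)"

text \<open>The type argument only selects the field.\<close>

definition algebraically_closed_field :: "'k::field itself \<Rightarrow> bool" where
  "algebraically_closed_field _ \<longleftrightarrow> (\<forall>p :: 'k poly. 0 < degree p \<longrightarrow> (\<exists>x. poly p x = 0))"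

section \<open>Monoid rings\<close>

text \<open>The monoid ring \<open>k[t;M]\<close> is the subring of the group ring \<open>'g \<Rightarrow>\<^sub>0 'k\<close> of elements with
  all exponents in \<open>M\<close>; \<open>t\<^sup>\<alpha>\<close> is \<open>Poly_Mapping.single \<alpha> 1\<close>.\<close>

definition monoid_ring :: "'g::linordered_ab_group_add set \<Rightarrow> ('g \<Rightarrow>\<^sub>0 'k::field) ring" where
  "monoid_ring M =
    \<lparr>carrier = {f. Poly_Mapping.keys f \<subseteq> M}, mult = (*), one = 1, zero = 0, add = (+)\<rparr>"

definition tM_ideal :: "'g::linordered_ab_group_add set \<Rightarrow> ('g \<Rightarrow>\<^sub>0 'k::field) set" where
  "tM_ideal M = Idl\<^bsub>monoid_ring M\<^esub>
     {Poly_Mapping.single \<alpha> 1 | \<alpha>. \<alpha> \<in> M \<and> \<alpha> \<noteq> 0 \<and> \<alpha> \<notin> Units (add_monoid_of M)}"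

text \<open>If \<open>gp M = UNIV\<close>, the group ring and \<open>k[t;M]\<close> have the same field of fractions, which is
  also that of the localization below (lemma \<open>quotient_of_localization\<close>). So the field of
  fractions of the localization is the type \<open>('g \<Rightarrow>\<^sub>0 'k) fract\<close>.\<close>

definition local_monoid_ring ::
  "'g::linordered_ab_group_add set \<Rightarrow> ('g \<Rightarrow>\<^sub>0 'k::field) fract set" where
  "local_monoid_ring M =
    {Fract f h | f h. f \<in> carrier (monoid_ring M) \<and> h \<in> carrier (monoid_ring M) - tM_ideal M}"

text \<open>The value at \<open>0\<close> (which is \<open>\<infinity>\<close> in the literature) is left unspecified.\<close>

definition M_valuation ::
  "'g::linordered_ab_group_add set \<Rightarrow> ('g \<Rightarrow>\<^sub>0 'k::field) fract \<Rightarrow> 'g" where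
  "M_valuation M x =
    (THE \<gamma>. \<exists>f\<in>carrier (monoid_ring M) - {0}. \<exists>h\<in>carrier (monoid_ring M) - {0}.
        x = Fract f h \<and> \<gamma> = Min (Poly_Mapping.keys f) - Min (Poly_Mapping.keys h))"

section \<open>Integer-valued rational functions\<close>

text \<open>A rational function has a value at \<open>a\<close> iff it can be written with a denominator that does
  not vanish at \<open>a\<close>; the value does not depend on the representation.\<close>

definition ratfun_value :: "'f::field poly fract \<Rightarrow> 'f \<Rightarrow> 'f \<Rightarrow> bool" where
  "ratfun_value \<phi> a y \<longleftrightarrow>
    (\<exists>p q. \<phi> = Fract p q \<and> poly q a \<noteq> 0 \<and> y = poly p a / poly q a)"

definition IntR :: "'f::field set \<Rightarrow> 'f poly fract set" where
  "IntR D = {\<phi>. \<forall>a. \<exists>y\<in>D. ratfun_value \<phi> a y}"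

definition const_ratfun :: "'f::field \<Rightarrow> 'f poly fract" where
  "const_ratfun d = Fract [:d:] 1"

section \<open>Well-definedness\<close>

lemma ratfun_value_unique:
  assumes "ratfun_value \<phi> a y" "ratfun_value \<phi> a z"
  shows "y = z"
proof -
  obtain p q r s where 1: "\<phi> = Fract p q" "poly q a \<noteq> 0" "y = poly p a / poly q a"
      "\<phi> = Fract r s" "poly s a \<noteq> 0" "z = poly r a / poly s a"
    using assms unfolding ratfun_value_def by blast
  then have "q \<noteq> 0" "s \<noteq> 0" by auto
  with 1 have "p * s = r * q" by (simp add: eq_fract)
  then have "poly p a * poly s a = poly r a * poly q a" by (metis poly_mult)
  with 1 show ?thesis by (simp add: frac_eq_eq)
qed

lemma keys_mult_submonoid:
  assumes "is_submonoid M" "Poly_Mapping.keys f \<subseteq> M" "Poly_Mapping.keys h \<subseteq> M"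
  shows "Poly_Mapping.keys (f * h) \<subseteq> M"
  using keys_mult[of f h] assms unfolding is_submonoid_def by blast

lemma cring_monoid_ring:
  assumes M: "is_submonoid M"
  shows "cring (monoid_ring M :: ('g::linordered_ab_group_add \<Rightarrow>\<^sub>0 'k::field) ring)"
proof (rule cringI)
  let ?R = "monoid_ring M :: ('g \<Rightarrow>\<^sub>0 'k) ring"
  show "abelian_group ?R"
  proof (rule abelian_groupI)
    fix x y assume "x \<in> carrier ?R" "y \<in> carrier ?R"
    then show "x \<oplus>\<^bsub>?R\<^esub> y \<in> carrier ?R"
      using Poly_Mapping.keys_add[of x y] by (auto simp: monoid_ring_def)
  next
    fix x assume "x \<in> carrier ?R"
    then show "\<exists>y\<in>carrier ?R. y \<oplus>\<^bsub>?R\<^esub> x = \<zero>\<^bsub>?R\<^esub>"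
      by (intro bexI[of _ "- x"]) (auto simp: monoid_ring_def)
  qed (auto simp: monoid_ring_def algebra_simps)
  show "Group.comm_monoid ?R"
    using M keys_mult_submonoid[OF M]
    by unfold_locales (auto simp: monoid_ring_def algebra_simps is_submonoid_def)
  show "(x \<oplus>\<^bsub>?R\<^esub> y) \<otimes>\<^bsub>?R\<^esub> z = x \<otimes>\<^bsub>?R\<^esub> z \<oplus>\<^bsub>?R\<^esub> y \<otimes>\<^bsub>?R\<^esub> z" for x y z
    by (simp add: monoid_ring_def algebra_simps)
qed

lemma Min_keys_mult:
  fixes f h :: "'g::linordered_ab_group_add \<Rightarrow>\<^sub>0 'k::field"
  assumes "f \<noteq> 0" "h \<noteq> 0"
  shows "Min (Poly_Mapping.keys (f * h)) = Min (Poly_Mapping.keys f) + Min (Poly_Mapping.keys h)"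
proof -
  let ?a = "Min (Poly_Mapping.keys f)" and ?b = "Min (Poly_Mapping.keys h)"
  have a: "?a \<in> Poly_Mapping.keys f" and b: "?b \<in> Poly_Mapping.keys h" using assms by (auto intro!: Min_in)
  have ge: "?a + ?b \<le> c" if c: "c \<in> Poly_Mapping.keys (f * h)" for c
  proof -
    obtain u w where "u \<in> Poly_Mapping.keys f" "w \<in> Poly_Mapping.keys h" "c = u + w" using c keys_mult[of f h] by blast
    then show ?thesis by (auto intro!: add_mono Min_le)
  qed
  have inner: "(\<Sum>q. Poly_Mapping.lookup h q when ?a + ?b = l + q) = Poly_Mapping.lookup h (?a + ?b - l)" for l
  proof -
    have "(\<lambda>q. Poly_Mapping.lookup h q when ?a + ?b = l + q) = (\<lambda>q. Poly_Mapping.lookup h q when q = ?a + ?b - l)"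
      by (rule ext, rule when_cong) (auto simp: algebra_simps)
    then show ?thesis by (simp only: Sum_any_when_equal)
  qed
  have "Poly_Mapping.lookup f l * Poly_Mapping.lookup h (?a + ?b - l) = (Poly_Mapping.lookup f ?a * Poly_Mapping.lookup h ?b when l = ?a)" for l
  proof (cases "l = ?a")
    case False
    have "l \<notin> Poly_Mapping.keys f \<or> ?a + ?b - l \<notin> Poly_Mapping.keys h"
    proof (rule ccontr)
      assume "\<not> ?thesis"
      then have "?a \<le> l" "?b \<le> ?a + ?b - l" by (auto intro: Min_le)
      then show False using False by (simp add: algebra_simps)
    qed
    with False show ?thesis by (auto simp: in_keys_iff)
  qed simp
  then have "Poly_Mapping.lookup (f * h) (?a + ?b) = Poly_Mapping.lookup f ?a * Poly_Mapping.lookup h ?b"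
    by (simp add: lookup_mult inner)
  with a b have "?a + ?b \<in> Poly_Mapping.keys (f * h)" by (simp add: in_keys_iff)
  with ge show ?thesis by (intro Min_eqI) auto
qed

lemma M_valuation_Fract:
  fixes f h :: "'g::linordered_ab_group_add \<Rightarrow>\<^sub>0 'k::field"
  assumes "Poly_Mapping.keys f \<subseteq> M" "Poly_Mapping.keys h \<subseteq> M" "f \<noteq> 0" "h \<noteq> 0"
  shows "M_valuation M (Fract f h) = Min (Poly_Mapping.keys f) - Min (Poly_Mapping.keys h)"
  unfolding M_valuation_def
proof (rule the_equality)
  show "\<exists>f'\<in>carrier (monoid_ring M) - {0}. \<exists>h'\<in>carrier (monoid_ring M) - {0}.
      Fract f h = Fract f' h' \<and> Min (Poly_Mapping.keys f) - Min (Poly_Mapping.keys h) = Min (Poly_Mapping.keys f') - Min (Poly_Mapping.keys h')"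
    using assms by (intro bexI[of _ f] bexI[of _ h]) (auto simp: monoid_ring_def)
next
  fix \<gamma>
  assume "\<exists>f'\<in>carrier (monoid_ring M) - {0}. \<exists>h'\<in>carrier (monoid_ring M) - {0}.
      Fract f h = Fract f' h' \<and> \<gamma> = Min (Poly_Mapping.keys f') - Min (Poly_Mapping.keys h')"
  then obtain f' h' where *: "f' \<noteq> 0" "h' \<noteq> 0" "Fract f h = Fract f' h'"
      "\<gamma> = Min (Poly_Mapping.keys f') - Min (Poly_Mapping.keys h')"
    by blast
  then have "f * h' = f' * h" using assms by (simp add: eq_fract)
  then have "Min (Poly_Mapping.keys f) + Min (Poly_Mapping.keys h') = Min (Poly_Mapping.keys f') + Min (Poly_Mapping.keys h)"
    using assms * by (metis Min_keys_mult)
  then show "\<gamma> = Min (Poly_Mapping.keys f) - Min (Poly_Mapping.keys h)"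
    unfolding *(4) by (metis add_diff_cancel_right' add_diff_eq diff_add_eq)
qed

lemma one_notin_tM_ideal:
  assumes M: "is_submonoid M" "positive M"
  shows "(1 :: 'g::linordered_ab_group_add \<Rightarrow>\<^sub>0 'k::field) \<notin> tM_ideal M"
proof -
  let ?R = "monoid_ring M :: ('g \<Rightarrow>\<^sub>0 'k) ring"
  let ?I = "{f \<in> carrier ?R. 0 \<notin> Poly_Mapping.keys f}"
  interpret cring ?R by (rule cring_monoid_ring[OF M(1)])
  have inv: "\<ominus>\<^bsub>?R\<^esub> f = - f" if "f \<in> carrier ?R" for f
    using that by (intro minus_equality) (auto simp: monoid_ring_def)
  have mem: "f * h \<in> ?I" if "f \<in> ?I" "h \<in> carrier ?R" for f h
  proof -
    have "0 \<notin> Poly_Mapping.keys (f * h)"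
    proof
      assume "0 \<in> Poly_Mapping.keys (f * h)"
      then obtain u w where "u \<in> Poly_Mapping.keys f" "w \<in> Poly_Mapping.keys h" "0 = u + w" using keys_mult[of f h] by blast
      moreover from this that have "0 \<le> u" "0 \<le> w" "u \<noteq> 0"
        using M(2) by (auto simp: positive_def monoid_ring_def)
      ultimately show False by (simp add: add_nonneg_eq_0_iff)
    qed
    with that keys_mult_submonoid[OF M(1)] show ?thesis by (auto simp: monoid_ring_def)
  qed
  have "ideal ?I ?R"
  proof (rule idealI)
    show "subgroup ?I (add_monoid ?R)"
    proof (rule add.subgroupI)
      show "?I \<noteq> {}" by (auto intro!: exI[of _ 0] simp: monoid_ring_def)
      show "\<ominus>\<^bsub>?R\<^esub> a \<in> ?I" if "a \<in> ?I" for a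
        using that inv[of a] by (auto simp: monoid_ring_def)
      show "a \<oplus>\<^bsub>?R\<^esub> b \<in> ?I" if "a \<in> ?I" "b \<in> ?I" for a b
        using that Poly_Mapping.keys_add[of a b] by (auto simp: monoid_ring_def)
    qed auto
    show "x \<otimes>\<^bsub>?R\<^esub> a \<in> ?I" "a \<otimes>\<^bsub>?R\<^esub> x \<in> ?I" if "a \<in> ?I" "x \<in> carrier ?R" for a x
      using mem[OF that] by (simp_all add: monoid_ring_def mult.commute)
  qed (rule ring_axioms)
  moreover have "{Poly_Mapping.single \<alpha> 1 | \<alpha>. \<alpha> \<in> M \<and> \<alpha> \<noteq> 0 \<and> \<alpha> \<notin> Units (add_monoid_of M)} \<subseteq> ?I"
    by (auto simp: monoid_ring_def)
  ultimately have "tM_ideal M \<subseteq> ?I" unfolding tM_ideal_def genideal_def by blast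
  moreover have "(1 :: 'g \<Rightarrow>\<^sub>0 'k) \<notin> ?I" by simp
  ultimately show ?thesis by blast
qed

lemma gp_common_shift:
  fixes M :: "'g::linordered_ab_group_add set"
  assumes "is_submonoid M" "gp M = UNIV" "finite S"
  shows "\<exists>\<mu>\<in>M. \<forall>s\<in>S. \<mu> + s \<in> M"
  using assms(3)
proof induction
  case empty
  then show ?case using assms(1) by (auto simp: is_submonoid_def)
next
  case (insert s S)
  then obtain \<mu> where \<mu>: "\<mu> \<in> M" "\<forall>s\<in>S. \<mu> + s \<in> M" by blast
  have "s \<in> gp M" using assms(2) by simp
  then obtain a b where s: "s = a - b" "a \<in> M" "b \<in> M" unfolding gp_def by blast
  have add: "x + y \<in> M" if "x \<in> M" "y \<in> M" for x y
    using assms(1) that by (auto simp: is_submonoid_def)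
  have "\<mu> + b + s' \<in> M" if "s' \<in> insert s S" for s'
  proof (cases "s' = s")
    case True
    have "\<mu> + b + s' = \<mu> + a" using s True by (simp add: algebra_simps)
    then show ?thesis using add[OF \<mu>(1) s(2)] by (simp only:)
  next
    case False
    have "\<mu> + b + s' = (\<mu> + s') + b" by (simp add: algebra_simps)
    moreover have "\<mu> + s' \<in> M" using \<mu> that False by blast
    ultimately show ?thesis using add s(3) by (simp only:)
  qed
  then show ?case using add \<mu> s by blast
qed

lemma quotient_of_localization:
  fixes x :: "('g::linordered_ab_group_add \<Rightarrow>\<^sub>0 'k::field) fract"
  assumes M: "is_submonoid M" "positive M" "gp M = UNIV"
  shows "\<exists>a\<in>local_monoid_ring M. \<exists>b\<in>local_monoid_ring M - {0}. x = a / b"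
proof -
  obtain f h where x: "x = Fract f h" "h \<noteq> 0" by (cases x) auto
  obtain \<mu> where \<mu>: "\<forall>s\<in>Poly_Mapping.keys f \<union> Poly_Mapping.keys h. \<mu> + s \<in> M"
    using gp_common_shift[OF M(1,3), of "Poly_Mapping.keys f \<union> Poly_Mapping.keys h"] by auto
  define m :: "'g \<Rightarrow>\<^sub>0 'k" where "m = Poly_Mapping.single \<mu> 1"
  have m0: "m \<noteq> 0" by (auto simp: m_def single_zero dest: arg_cong[of _ _ Poly_Mapping.keys])
  have k: "Poly_Mapping.keys (m * f) \<subseteq> M" "Poly_Mapping.keys (m * h) \<subseteq> M"
    using keys_mult[of m f] keys_mult[of m h] \<mu> by (auto simp: m_def)
  have one: "(1 :: 'g \<Rightarrow>\<^sub>0 'k) \<in> carrier (monoid_ring M) - tM_ideal M"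
    using one_notin_tM_ideal[OF M(1,2)] M(1) by (auto simp: monoid_ring_def is_submonoid_def)
  have D: "Fract (m * u) 1 \<in> local_monoid_ring M" if "Poly_Mapping.keys (m * u) \<subseteq> M" for u
    using that one unfolding local_monoid_ring_def
    by (intro CollectI exI[of _ "m * u"] exI[of _ 1]) (simp add: monoid_ring_def)
  show ?thesis
  proof (intro bexI)
    show "x = Fract (m * f) 1 / Fract (m * h) 1"
      using x m0 by (simp add: divide_fract eq_fract ac_simps)
    show "Fract (m * h) 1 \<in> local_monoid_ring M - {0}"
      using D[OF k(2)] x m0 by (auto simp: Zero_fract_def eq_fract)
  qed (rule D[OF k(1)])
qed

end

theory Submission
  imports Defs
begin

text \<open>For a nonvanishing rational function \<open>\<phi>\<close> the values \<open>v (\<phi> a)\<close> satisfy an intermediate value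
  property: along annuli around a point they are given by the Newton functions
  \<open>\<gamma> \<mapsto> min (v p\<^sub>i + i \<gamma>)\<close> of numerator and denominator, which are Lipschitz. Hence for integer-valued
  \<open>\<phi>\<close> they cannot cross a gap of \<open>M\<close>. The gap above \<open>0\<close> shows that being a unit can be tested at a
  single point, so atoms of \<open>D\<close> stay atoms and evaluation at \<open>0\<close> turns a factorization over
  \<open>IntR D\<close> into one over \<open>D\<close>. The gap \<open>(\<beta>, \<alpha>)\<close> shows that \<open>\<phi>\<close> is irreducible as soon as it takes values
  slightly above \<open>\<alpha>\<close> as well as values above \<open>2 \<beta>\<close>. Such functions with constant product \<open>d\<close> are built
  from a polynomial \<open>h\<close> with \<open>v (h a) = min (m v a) \<delta>\<close>, which exists because \<open>k\<close> is not algebraically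
  closed or \<open>\<Gamma>\<close> is not divisible.\<close>

section \<open>Dense archimedean ordered groups\<close>

text \<open>Integral terminality only says that multiples of a positive element pass \<alpha>.
  Bounded factorization supplies the rest: if \<alpha> had bounded multiples, or if \<open>M\<close>
  had positive elements arbitrarily close to 0, a fixed element above \<alpha> would split into
  arbitrarily many summands. Hence \<Gamma> is archimedean and \<open>M\<close> has a gap above 0;
  as \<Gamma> has no least positive element it is also dense, which the walk behind the intermediate
  value property needs. The polynomial \<open>h\<close> yields bumps because its value is truncated
  at \<delta>: dividing a dilate of \<open>h\<close> by \<open>h\<close> itself leaves a value that
  is positive only inside one disc. The bound N - 2 is a budget. In a factorization of length n, n -
  1 factors take a base value slightly above \<alpha>, and the last one must keep more than \<alpha>
  + \<beta>, so that it can both exceed 2 \<beta> and dip close to \<alpha>; for this (n + 1)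
  \<alpha> \<le> v(d) is enough. Since v(d) > 3 \<alpha>, d is a product of two elements of value
  above \<alpha>, which lie in \<open>D\<close>; this excludes length 1.\<close>

lemma nmult_0 [simp]: "nmult 0 x = 0"
  by (simp add: nmult_def)

lemma nmult_zero_right [simp]: "nmult n (0::'a::comm_monoid_add) = 0"
  by (simp add: nmult_def)

lemma nmult_Suc: "nmult (Suc n) x = x + nmult n x"
  by (simp add: nmult_def add.commute)

lemma nmult_1 [simp]: "nmult (Suc 0) x = x"
  by (simp add: nmult_Suc)

lemma nmult_add: "nmult (m + n) x = nmult m x + nmult n x"
  by (induction m) (simp_all add: nmult_Suc add.assoc)

lemma nmult_add_right: "nmult n (x + y) = nmult n x + nmult n y"
  by (simp add: nmult_def sum.distrib)

lemma nmult_minus: "nmult n (- x :: 'a::ab_group_add) = - nmult n x"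
  by (simp add: nmult_def sum_negf)

lemma nmult_diff: "nmult n (x - y :: 'a::ab_group_add) = nmult n x - nmult n y"
  by (simp add: nmult_def sum_subtractf)

lemma nmult_mult: "nmult (m * n) x = nmult m (nmult n x)"
  by (induction m) (simp_all add: nmult_Suc nmult_add)

lemma nmult_mono:
  fixes x y :: "'a::linordered_ab_group_add"
  shows "x \<le> y \<Longrightarrow> nmult n x \<le> nmult n y"
  by (simp add: nmult_def sum_mono)

lemma nmult_strict_mono:
  fixes x y :: "'a::linordered_ab_group_add"
  assumes "x < y" "0 < n"
  shows "nmult n x < nmult n y"
  using assms(2)
proof (induction n)
  case (Suc n)
  then show ?case using assms(1) nmult_mono[of x y n]
    by (simp add: nmult_Suc add_less_le_mono)
qed simp

lemma nmult_nonneg: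
  fixes x :: "'a::linordered_ab_group_add"
  shows "0 \<le> x \<Longrightarrow> 0 \<le> nmult n x"
  using nmult_mono[of 0 x n] by simp

lemma nmult_pos:
  fixes x :: "'a::linordered_ab_group_add"
  shows "0 < x \<Longrightarrow> 0 < n \<Longrightarrow> 0 < nmult n x"
  using nmult_strict_mono[of 0 x n] by simp

lemma nmult_mono_left:
  fixes x :: "'a::linordered_ab_group_add"
  assumes "0 \<le> x" "m \<le> n"
  shows "nmult m x \<le> nmult n x"
proof -
  have "nmult n x = nmult m x + nmult (n - m) x"
    using assms by (simp flip: nmult_add)
  then show ?thesis using nmult_nonneg[OF assms(1)] by simp
qed

lemma nmult_inject:
  fixes x y :: "'a::linordered_ab_group_add"
  assumes "nmult n x = nmult n y" "0 < n"
  shows "x = y"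
  using assms nmult_strict_mono[of x y n] nmult_strict_mono[of y x n]
  by (metis less_irrefl linorder_less_linear)

section \<open>Archimedean ordered groups without a least positive element\<close>

locale dense_archimedean =
  fixes G :: "'g::linordered_ab_group_add itself"
  assumes archimedean: "0 < (x::'g) \<Longrightarrow> \<exists>n. y < nmult n x"
    and dense0: "0 < (x::'g) \<Longrightarrow> \<exists>y. 0 < y \<and> y < x"
begin

text \<open>The slack \<open>x - nmult n y\<close> is positive, so a positive \<open>w\<close> below
  both \<open>y\<close> and the slack allows one more summand. This replaces the quotient x / n,
  which need not exist in the group.\<close>

lemma small_multiple:
  assumes "0 < (x::'g)"
  shows "\<exists>y. 0 < y \<and> nmult n y < x"
proof (induction n)
  case 0
  then show ?case using dense0[OF assms] assms by auto
next
  case (Suc n)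
  then obtain y where y: "0 < y" "nmult n y < x" by blast
  define z where "z = min y (x - nmult n y)"
  have "0 < z" using y by (simp add: z_def)
  then obtain w where w: "0 < w" "w < z" using dense0 by blast
  have "nmult n w \<le> nmult n y" using w by (intro nmult_mono) (auto simp: z_def)
  moreover have "w < x - nmult n y" using w by (simp add: z_def)
  ultimately have "nmult (Suc n) w < x"
    by (simp add: nmult_Suc less_diff_eq) (metis add_left_mono le_less_trans)
  with w show ?case by blast
qed

lemma dense:
  assumes "(x::'g) < y"
  shows "\<exists>z. x < z \<and> z < y"
proof -
  obtain e where "0 < e" "e < y - x" using dense0[of "y - x"] assms by auto
  then show ?thesis by (intro exI[of _ "x + e"]) (simp add: algebra_simps)
qed

lemma interval_avoids_finite:
  assumes "finite B" "(x::'g) < y"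
  shows "\<exists>z. x < z \<and> z < y \<and> z \<notin> B"
  using assms
proof (induction arbitrary: y)
  case empty
  then show ?case using dense by simp
next
  case (insert b B)
  show ?case
  proof (cases "x < b")
    case True
    then have "x < min y b" using insert by simp
    from insert.IH[OF this] show ?thesis by auto
  next
    case False
    from insert.IH[OF insert.prems] False show ?thesis by auto
  qed
qed

text \<open>Multiples of \<open>nmult m e\<close> with steps shorter than the interval cannot jump
  over it, so the first one beyond \<open>x\<close> lies inside. Bump heights, which have the form
  \<open>nmult m \<kappa>\<close>, are chosen this way.\<close>

lemma multiples_dense:
  assumes "0 \<le> (x::'g)" "x < y" "0 < m"
  shows "\<exists>z. 0 < z \<and> x < nmult m z \<and> nmult m z < y"
proof -
  obtain e where e: "0 < e" "nmult m e < y - x" using small_multiple[of "y - x" m] assms by auto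
  let ?f = "nmult m e"
  have f: "0 < ?f" using e assms nmult_pos by blast
  obtain k where k: "x < nmult k ?f" "\<And>j. j < k \<Longrightarrow> \<not> x < nmult j ?f"
    using archimedean[OF f, of x] exists_least_iff[of "\<lambda>k. x < nmult k ?f"] by blast
  then obtain j where j: "k = Suc j" using assms(1) by (cases k) auto
  with k(2)[of j] have "nmult k ?f \<le> x + ?f" by (simp add: nmult_Suc add.commute not_less)
  with e have "nmult k ?f < y" by (simp add: less_diff_eq add.commute)
  moreover have "nmult k ?f = nmult m (nmult k e)" by (simp flip: nmult_mult add: mult.commute)
  moreover have "0 < nmult k e" using e j nmult_pos by blast
  ultimately show ?thesis using k(1) by metis
qed

text \<open>A walk from \<open>a\<close> to \<open>b\<close> in sufficiently small steps cannot jump over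
  the middle of \<open>(x, y)\<close>, and a whole interval after the first step beyond
  it is mapped into \<open>(x, y)\<close>.\<close>

lemma lipschitz_ivp_aux:
  fixes f :: "'g \<Rightarrow> 'g"
  assumes lip: "\<And>u w. u \<le> w \<Longrightarrow> f w \<le> f u + nmult n (w - u) \<and> f u \<le> f w + nmult n (w - u)"
    and "a \<le> b" "f a \<le> x" "x < y" "y \<le> f b" "finite B"
  shows "\<exists>c. c \<notin> B \<and> x < f c \<and> f c < y"
proof -
  \<comment> \<open>Three widths \<open>u\<close> are needed: the walk stops on first passing
    \<open>x + u\<close>, overshoots by less than \<open>u\<close>, and moving on to a point outside
    \<open>B\<close> changes the value by less than \<open>u\<close> again.\<close>
  obtain u where u: "0 < u" "nmult 3 u < y - x" using small_multiple[of "y - x" 3] assms by auto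
  have u3: "x + u + u + u < y"
    using u(2) by (simp add: numeral_3_eq_3 nmult_Suc algebra_simps)
  obtain e where e: "0 < e" "nmult n e < u" using small_multiple[OF u(1)] by blast
  have step: "f w' < f w + u" "f w < f w' + u" if "w \<le> w'" "w' \<le> w + e" for w w'
  proof -
    have "w' - w \<le> e" using that by (simp add: algebra_simps)
    then have "nmult n (w' - w) \<le> nmult n e" by (rule nmult_mono)
    with e have "nmult n (w' - w) < u" by simp
    then have "f w + nmult n (w' - w) < f w + u" "f w' + nmult n (w' - w) < f w' + u" by simp_all
    with lip[OF that(1)] show "f w' < f w + u" "f w < f w' + u" by (auto intro: le_less_trans)
  qed
  define s where "s k = min (a + nmult k e) b" for k
  obtain K where "b - a < nmult K e" using archimedean[OF e(1)] by blast
  then have "b < a + nmult K e" by (simp add: algebra_simps)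
  then have "s K = b" by (simp add: s_def)
  moreover have "x + u < f b"
  proof -
    have "x + u + 0 + 0 \<le> x + u + u + u" using u by (intro add_mono) auto
    then have "x + u \<le> x + u + u + u" by (simp only: add_0_right)
    with u3 assms show ?thesis by order
  qed
  ultimately have "x + u < f (s K)" by simp
  then obtain k where k: "x + u < f (s k)" "\<And>j. j < k \<Longrightarrow> \<not> x + u < f (s j)"
    using exists_least_iff[of "\<lambda>k. x + u < f (s k)"] by blast
  have "s 0 = a" using assms by (simp add: s_def)
  moreover have "f a \<le> x + u" using assms u by (simp add: add_increasing2)
  ultimately have "k \<noteq> 0" using k(1) by (cases k) auto
  then obtain j where j: "k = Suc j" by (cases k) auto
  have "a + nmult k e = a + nmult j e + e" by (simp add: j nmult_Suc algebra_simps)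
  then have "s j \<le> s k" "s k \<le> s j + e"
    using e by (auto simp: s_def min_le_iff_disj min_add_distrib_left add_increasing2)
  from step(1)[OF this] k(2)[of j] j have sk: "f (s k) < x + u + u"
    by (metis add_right_mono lessI not_less less_le_trans)
  obtain c where c: "s k < c" "c < s k + e" "c \<notin> B"
    using interval_avoids_finite[OF assms(6), of "s k" "s k + e"] e by auto
  have *: "f c < f (s k) + u" "f (s k) < f c + u" using step[of "s k" c] c by simp_all
  have "f c < x + u + u + u" using less_trans[OF *(1) add_strict_right_mono[OF sk]] .
  moreover have "x + u < f c + u" using less_trans[OF k(1) *(2)] .
  ultimately show ?thesis using u3 c by (intro exI[of _ c]) auto
qed

lemma lipschitz_ivp:
  fixes f :: "'g \<Rightarrow> 'g"
  assumes lip: "\<And>u w. u \<le> w \<Longrightarrow> f w \<le> f u + nmult n (w - u) \<and> f u \<le> f w + nmult n (w - u)"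
    and *: "f a \<le> x" "x < y" "y \<le> f b" "finite B"
  shows "\<exists>c. c \<notin> B \<and> x < f c \<and> f c < y"
proof (cases "a \<le> b")
  case True
  with lipschitz_ivp_aux[OF lip] * show ?thesis by blast
next
  case False
  \<comment> \<open>Reflection keeps the Lipschitz bound and puts the two endpoints in increasing
    order.\<close>
  have "f (- w) \<le> f (- u) + nmult n (w - u) \<and> f (- u) \<le> f (- w) + nmult n (w - u)"
    if "u \<le> w" for u w
    using lip[of "- w" "- u"] that by (simp add: conj_commute)
  from lipschitz_ivp_aux[of "\<lambda>u. f (- u)", OF this, of "- a" "- b" x y "uminus ` B"] False *
  show ?thesis by force
qed

end

section \<open>Valued fields\<close>

text \<open>The value of 0 is arbitrary rather than infinite, hence the nonzero side conditions here
  and the separate treatment of 0 later.\<close>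

locale valued_field =
  fixes val :: "'f::field \<Rightarrow> 'g::linordered_ab_group_add"
  assumes val_mult: "x \<noteq> 0 \<Longrightarrow> y \<noteq> 0 \<Longrightarrow> val (x * y) = val x + val y"
    and val_add: "x \<noteq> 0 \<Longrightarrow> y \<noteq> 0 \<Longrightarrow> x + y \<noteq> 0 \<Longrightarrow> min (val x) (val y) \<le> val (x + y)"
    and val_surj: "\<exists>x. x \<noteq> 0 \<and> val x = \<gamma>"
begin

lemma val_1 [simp]: "val 1 = 0"
  using val_mult[of 1 1] by simp

lemma val_power: "x \<noteq> 0 \<Longrightarrow> val (x ^ n) = nmult n (val x)"
  by (induction n) (simp_all add: nmult_Suc val_mult)

lemma val_inverse: "x \<noteq> 0 \<Longrightarrow> val (inverse x) = - val x"
  using val_mult[of x "inverse x"] by (simp add: eq_neg_iff_add_eq_0 add.commute)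

lemma val_divide: "x \<noteq> 0 \<Longrightarrow> y \<noteq> 0 \<Longrightarrow> val (x / y) = val x - val y"
  by (simp add: divide_inverse val_mult val_inverse)

lemma val_minus: "val (- x) = val x"
proof (cases "x = 0")
  case False
  have "val (- 1) + val (- 1) = 0" using val_mult[of "- 1" "- 1"] by simp
  then have "val (- 1) = 0" by simp
  with False show ?thesis using val_mult[of "- 1" x] by simp
qed simp

text \<open>If the sum had a larger value than \<open>x\<close>, subtracting \<open>y\<close> again
  would give \<open>x\<close> a larger value than it has.\<close>

lemma val_add_less:
  assumes "x \<noteq> 0" "y \<noteq> 0" "val x < val y"
  shows "x + y \<noteq> 0" "val (x + y) = val x"
proof -
  show nz: "x + y \<noteq> 0"
  proof
    assume "x + y = 0"
    then have "y = - x" by (simp add: eq_neg_iff_add_eq_0 add.commute)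
    with assms show False by (simp add: val_minus)
  qed
  have "val x \<le> val (x + y)" using val_add[OF assms(1,2) nz] assms by simp
  moreover have "min (val (x + y)) (val y) \<le> val x"
    using val_add[of "x + y" "- y"] nz assms by (simp add: val_minus)
  then have "val (x + y) \<le> val x" using assms by (auto simp: min_le_iff_disj)
  ultimately show "val (x + y) = val x" by simp
qed

lemma val_add_neq:
  assumes "x \<noteq> 0" "y \<noteq> 0" "val x \<noteq> val y"
  shows "x + y \<noteq> 0" "val (x + y) = min (val x) (val y)"
  using assms val_add_less[of x y] val_add_less[of y x]
  by (cases "val x < val y"; simp add: add.commute min_def)+

lemma val_sum_distinct:
  assumes "finite S" "S \<noteq> {}" "\<And>i. i \<in> S \<Longrightarrow> f i \<noteq> 0" "inj_on (\<lambda>i. val (f i)) S"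
  shows "sum f S \<noteq> 0 \<and> val (sum f S) = Min ((\<lambda>i. val (f i)) ` S)"
  using assms
proof (induction rule: finite_ne_induct)
  case (insert i S)
  then have IH: "sum f S \<noteq> 0" "val (sum f S) = Min ((\<lambda>i. val (f i)) ` S)"
    by (auto simp: inj_on_insert)
  have "val (sum f S) \<in> (\<lambda>i. val (f i)) ` S" unfolding IH(2) using insert by (intro Min_in) auto
  moreover have "val (f i) \<notin> (\<lambda>i. val (f i)) ` S" using insert by auto
  ultimately have "val (f i) \<noteq> val (sum f S)" by metis
  from val_add_neq[OF _ IH(1) this] show ?case
    using insert IH by simp
qed simp

lemma val_prod: "finite S \<Longrightarrow> (\<And>i. i \<in> S \<Longrightarrow> f i \<noteq> 0) \<Longrightarrow> val (prod f S) = (\<Sum>i\<in>S. val (f i))"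
  by (induction S rule: finite_induct) (simp_all add: val_mult)

section \<open>Newton functions of polynomials\<close>

definition newton :: "'f poly \<Rightarrow> 'g \<Rightarrow> 'g" where
  "newton p \<gamma> = Min ((\<lambda>i. val (coeff p i) + nmult i \<gamma>) ` {i. coeff p i \<noteq> 0})"

text \<open>Contains the tropical roots of \<open>p\<close>. Ties between any two monomials are
  excluded, not only ties for the minimum, so that \<open>val_sum_distinct\<close> applies
  directly.\<close>

definition critical :: "'f poly \<Rightarrow> 'g set" where
  "critical p = {\<gamma>. \<not> inj_on (\<lambda>i. val (coeff p i) + nmult i \<gamma>) {i. coeff p i \<noteq> 0}}"

lemma supp_subset: "{i. coeff p i \<noteq> 0} \<subseteq> {..degree p}"
  by (auto intro: le_degree)

lemma finite_supp: "finite {i. coeff p i \<noteq> 0}"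
  using supp_subset finite_subset by blast

lemma supp_nonempty: "p \<noteq> 0 \<Longrightarrow> {i. coeff p i \<noteq> 0} \<noteq> {}"
  using leading_coeff_neq_0 by blast

text \<open>Monomials of different degrees have different slopes in \<gamma>, and an ordered group
  has no torsion, so each pair ties for at most one \<gamma>.\<close>

lemma finite_critical: "finite (critical p)"
proof -
  let ?S = "{i. coeff p i \<noteq> 0}"
  define E where "E i j = {\<gamma>. val (coeff p i) + nmult i \<gamma> = val (coeff p j) + nmult j \<gamma>}" for i j
  have E_commute: "E i j = E j i" for i j unfolding E_def by (rule Collect_cong) (rule eq_commute)
  have fin: "finite (E i j)" if "i < j" for i j
  proof -
    have *: "nmult (j - i) \<gamma> = val (coeff p i) - val (coeff p j)" if "\<gamma> \<in> E i j" for \<gamma>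
    proof -
      have "nmult j \<gamma> = nmult i \<gamma> + nmult (j - i) \<gamma>" using \<open>i < j\<close> by (simp flip: nmult_add)
      moreover have "val (coeff p i) + nmult i \<gamma> = val (coeff p j) + nmult j \<gamma>" using that by (simp add: E_def)
      ultimately have "nmult i \<gamma> + val (coeff p i) = nmult i \<gamma> + (val (coeff p j) + nmult (j - i) \<gamma>)"
        by (simp only: ac_simps)
      then show ?thesis by (simp only: add_left_cancel add_diff_cancel_left')
    qed
    have "\<gamma> = \<gamma>'" if "\<gamma> \<in> E i j" "\<gamma>' \<in> E i j" for \<gamma> \<gamma>'
      by (rule nmult_inject[of "j - i"]) (use *[OF that(1)] *[OF that(2)] \<open>i < j\<close> in simp_all)
    then have "E i j = {} \<or> (\<exists>\<gamma>. E i j = {\<gamma>})" by blast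
    then show ?thesis by (metis finite.emptyI finite.insertI)
  qed
  have "critical p \<subseteq> (\<Union>i\<in>?S. \<Union>j\<in>{j\<in>?S. i < j}. E i j)"
  proof
    fix \<gamma> assume "\<gamma> \<in> critical p"
    then obtain i j where ij: "i \<in> ?S" "j \<in> ?S" "i \<noteq> j" "\<gamma> \<in> E i j"
      unfolding critical_def inj_on_def E_def by blast
    show "\<gamma> \<in> (\<Union>i\<in>?S. \<Union>j\<in>{j\<in>?S. i < j}. E i j)"
    proof (cases "i < j")
      case True
      with ij show ?thesis by blast
    next
      case False
      with ij have "j < i" "\<gamma> \<in> E j i" using E_commute by auto
      with ij show ?thesis by blast
    qed
  qed
  moreover have "finite (\<Union>i\<in>?S. \<Union>j\<in>{j\<in>?S. i < j}. E i j)"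
    using finite_supp[of p] fin by (intro finite_UN_I) auto
  ultimately show ?thesis using finite_subset by blast
qed

lemma val_poly_newton:
  assumes "p \<noteq> 0" "x \<noteq> 0" "val x \<notin> critical p"
  shows "poly p x \<noteq> 0 \<and> val (poly p x) = newton p (val x)"
proof -
  let ?S = "{i. coeff p i \<noteq> 0}" and ?f = "\<lambda>i. coeff p i * x ^ i"
  have s: "poly p x = sum ?f ?S"
    unfolding poly_altdef by (rule sum.mono_neutral_right) (use supp_subset in auto)
  have v: "val (?f i) = val (coeff p i) + nmult i (val x)" if "i \<in> ?S" for i
    using that assms by (simp add: val_mult val_power)
  have inj: "inj_on (\<lambda>i. val (?f i)) ?S"
    using assms(3) v by (auto simp: critical_def inj_on_def)
  have img: "(\<lambda>i. val (?f i)) ` ?S = (\<lambda>i. val (coeff p i) + nmult i (val x)) ` ?S"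
    using v by (intro image_cong) auto
  have nz: "?f i \<noteq> 0" if "i \<in> ?S" for i using that assms(2) by simp
  show ?thesis
    using val_sum_distinct[OF finite_supp supp_nonempty[OF assms(1)] nz inj]
    unfolding s newton_def img .
qed

text \<open>A minimum of functions with slopes between 0 and \<open>degree p\<close> inherits both
  bounds.\<close>

lemma newton_lipschitz:
  assumes "p \<noteq> 0" "\<gamma> \<le> \<gamma>'"
  shows "newton p \<gamma> \<le> newton p \<gamma>'" "newton p \<gamma>' \<le> newton p \<gamma> + nmult (degree p) (\<gamma>' - \<gamma>)"
proof -
  let ?S = "{i. coeff p i \<noteq> 0}" and ?T = "\<lambda>\<gamma> i. val (coeff p i) + nmult i \<gamma>"
  have S: "finite ?S" "?S \<noteq> {}" using finite_supp supp_nonempty[OF assms(1)] by auto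
  have le: "newton p \<gamma> \<le> ?T \<gamma> i" if "i \<in> ?S" for i \<gamma>
    unfolding newton_def using S that by (intro Min_le) auto
  have ex: "\<exists>i\<in>?S. newton p \<gamma> = ?T \<gamma> i" for \<gamma>
  proof -
    have "newton p \<gamma> \<in> ?T \<gamma> ` ?S" unfolding newton_def using S by (intro Min_in) auto
    then show ?thesis by auto
  qed
  obtain i where i: "i \<in> ?S" "newton p \<gamma>' = ?T \<gamma>' i" using ex by blast
  show "newton p \<gamma> \<le> newton p \<gamma>'"
    using le[OF i(1), of \<gamma>] nmult_mono[OF assms(2), of i] i(2) by (metis add_left_mono order_trans)
  obtain j where j: "j \<in> ?S" "newton p \<gamma> = ?T \<gamma> j" using ex by blast
  have "j \<le> degree p" using j by (auto intro: le_degree)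
  have "newton p \<gamma>' \<le> ?T \<gamma>' j" using le[OF j(1)] .
  also have "\<dots> = ?T \<gamma> j + nmult j (\<gamma>' - \<gamma>)" by (simp add: nmult_diff)
  also have "\<dots> \<le> newton p \<gamma> + nmult (degree p) (\<gamma>' - \<gamma>)"
    unfolding j(2) using assms(2) \<open>j \<le> degree p\<close> by (intro add_left_mono nmult_mono_left) auto
  finally show "newton p \<gamma>' \<le> newton p \<gamma> + nmult (degree p) (\<gamma>' - \<gamma>)" .
qed

text \<open>A large \<gamma> lifts every other monomial above the constant one. For a recentred
  polynomial, small circles thus show the value at the centre.\<close>

lemma newton_large:
  assumes "coeff p 0 \<noteq> 0"
  shows "\<exists>b. \<forall>\<gamma>>b. newton p \<gamma> = val (coeff p 0)"
proof -
  let ?S = "{i. coeff p i \<noteq> 0}"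
  define b where "b = Max (insert 0 ((\<lambda>i. val (coeff p 0) - val (coeff p i)) ` ?S))"
  have b: "0 \<le> b" "\<And>i. i \<in> ?S \<Longrightarrow> val (coeff p 0) - val (coeff p i) \<le> b"
    unfolding b_def using finite_supp by (auto intro!: Max_ge)
  have "newton p \<gamma> = val (coeff p 0)" if \<gamma>: "b < \<gamma>" for \<gamma>
    unfolding newton_def
  proof (rule Min_eqI)
    fix y assume "y \<in> (\<lambda>i. val (coeff p i) + nmult i \<gamma>) ` ?S"
    then obtain i where i: "i \<in> ?S" "y = val (coeff p i) + nmult i \<gamma>" by blast
    show "val (coeff p 0) \<le> y"
    proof (cases i)
      case (Suc j)
      have "nmult 1 \<gamma> \<le> nmult i \<gamma>" using Suc b \<gamma> by (intro nmult_mono_left) auto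
      then have "b \<le> nmult i \<gamma>" using \<gamma> by simp
      with b(2)[OF i(1)] have "val (coeff p 0) - val (coeff p i) \<le> nmult i \<gamma>" by order
      with i show ?thesis by (simp add: algebra_simps)
    qed (use i in simp)
  next
    show "val (coeff p 0) \<in> (\<lambda>i. val (coeff p i) + nmult i \<gamma>) ` ?S"
      using assms by (intro image_eqI[of _ _ 0]) auto
  qed (use finite_supp in auto)
  then show ?thesis by blast
qed

end

section \<open>Intermediate values of nonvanishing rational functions\<close>

locale dense_valued_field = valued_field val + dense_archimedean "TYPE('g)"
  for val :: "'f::field \<Rightarrow> 'g::linordered_ab_group_add"
begin

definition nonvanishing :: "'f poly fract \<Rightarrow> bool" where
  "nonvanishing \<phi> \<longleftrightarrow> (\<forall>a. \<exists>y. y \<noteq> 0 \<and> ratfun_value \<phi> a y)"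

definition ev :: "'f poly fract \<Rightarrow> 'f \<Rightarrow> 'f" where
  "ev \<phi> a = (THE y. ratfun_value \<phi> a y)"

lemma ev_eqI: "ratfun_value \<phi> a y \<Longrightarrow> ev \<phi> a = y"
  unfolding ev_def using ratfun_value_unique by blast

lemma nonvanishingD: "nonvanishing \<phi> \<Longrightarrow> ratfun_value \<phi> a (ev \<phi> a) \<and> ev \<phi> a \<noteq> 0"
  unfolding nonvanishing_def using ev_eqI by metis

text \<open>A denominator of least degree serves all points at once: comparison with a fraction
  defined at a root \<open>a\<close> of it shows that \<open>a\<close> is also a root of the
  numerator, so the common linear factor could be cancelled.\<close>

lemma nonvanishing_quotient:
  assumes "nonvanishing \<phi>"
  obtains p q where "\<And>a. poly p a \<noteq> 0" "\<And>a. poly q a \<noteq> 0" "\<And>a. ev \<phi> a = poly p a / poly q a"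
proof -
  obtain p0 q0 where "\<phi> = Fract p0 q0" "q0 \<noteq> 0" by (cases \<phi>) auto
  then obtain q where q: "\<exists>p. \<phi> = Fract p q" "q \<noteq> 0"
      "\<And>r. (\<exists>p. \<phi> = Fract p r) \<Longrightarrow> r \<noteq> 0 \<Longrightarrow> degree q \<le> degree r"
    using ex_has_least_nat[of "\<lambda>q. (\<exists>p. \<phi> = Fract p q) \<and> q \<noteq> 0" q0 degree] by blast
  then obtain p where p: "\<phi> = Fract p q" by blast
  have val_eq: "poly p a * poly s a = poly r a * poly q a"
    if "\<phi> = Fract r s" "poly s a \<noteq> 0" for r s a
  proof -
    have "s \<noteq> 0" using that by auto
    then have "p * s = r * q" using p q(2) that by (simp add: eq_fract)
    then show ?thesis by (metis poly_mult)
  qed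
  have qa: "poly q a \<noteq> 0" for a
  proof
    assume 0: "poly q a = 0"
    obtain y where "ratfun_value \<phi> a y" using nonvanishingD[OF assms] by blast
    then obtain r s where "\<phi> = Fract r s" "poly s a \<noteq> 0" unfolding ratfun_value_def by blast
    with val_eq[OF this] 0 have "poly p a = 0" by simp
    with 0 obtain p1 q1 where pq: "p = [:- a, 1:] * p1" "q = [:- a, 1:] * q1"
      by (auto simp: poly_eq_0_iff_dvd dvd_def)
    with q(2) have "q1 \<noteq> 0" by auto
    moreover have "\<phi> = Fract p1 q1"
      unfolding p using \<open>q1 \<noteq> 0\<close> q(2) by (simp add: eq_fract) (simp only: pq mult_ac)
    ultimately have "degree q \<le> degree q1" using q(3) by blast
    moreover have "degree q = 1 + degree q1" unfolding pq using \<open>q1 \<noteq> 0\<close> by (subst degree_mult_eq) auto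
    ultimately show False by simp
  qed
  have e: "ev \<phi> a = poly p a / poly q a" for a
    using p qa by (intro ev_eqI) (auto simp: ratfun_value_def)
  moreover have "poly p a \<noteq> 0" for a using e[of a] nonvanishingD[OF assms, of a] by auto
  ultimately show ?thesis using that qa by blast
qed

text \<open>Two points are joined by passing through a point \<open>c\<close> of very negative valuation, which
  lies in a generic annulus around each of them.\<close>

lemma ratfun_ivp:
  assumes \<phi>: "nonvanishing \<phi>" and "val (ev \<phi> a) \<le> x" "x < y" "y \<le> val (ev \<phi> b)"
  shows "\<exists>c. x < val (ev \<phi> c) \<and> val (ev \<phi> c) < y"
proof -
  obtain p q where pq: "\<And>a. poly p a \<noteq> 0" "\<And>a. poly q a \<noteq> 0" "\<And>a. ev \<phi> a = poly p a / poly q a"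
    using nonvanishing_quotient[OF \<phi>] by blast
  \<comment> \<open>Recentring at \<open>c\<close>: the Newton functions of \<open>P c\<close> and
    \<open>Q c\<close> describe \<phi> on the circles around \<open>c\<close>.\<close>
  define P where "P c = pcompose p [:c, 1:]" for c
  define Q where "Q c = pcompose q [:c, 1:]" for c
  define B where "B c = critical (P c) \<union> critical (Q c)" for c
  define H where "H c \<gamma> = newton (P c) \<gamma> - newton (Q c) \<gamma>" for c \<gamma>
  have poly_PQ: "poly (P c) z = poly p (c + z)" "poly (Q c) z = poly q (c + z)" for c z
    by (simp_all add: P_def Q_def poly_pcompose)
  have nz: "P c \<noteq> 0" "Q c \<noteq> 0" for c
    using poly_PQ[of c 0] pq by (metis poly_0)+
  have finB: "finite (B c)" for c by (simp add: B_def finite_critical)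
  have H: "val (ev \<phi> (c + z)) = H c (val z)" if "z \<noteq> 0" "val z \<notin> B c" for c z
    using val_poly_newton[OF nz(1)[of c] that(1)] val_poly_newton[OF nz(2)[of c] that(1)] that(2)
    by (simp add: pq(3) B_def H_def val_divide poly_PQ)
  have large: "\<exists>b. \<forall>\<gamma>>b. H c \<gamma> = val (ev \<phi> c)" for c
  proof -
    have c0: "coeff (P c) 0 = poly p c" "coeff (Q c) 0 = poly q c"
      using poly_PQ[of c 0] by (simp_all add: poly_0_coeff_0)
    obtain b1 b2 where "\<forall>\<gamma>>b1. newton (P c) \<gamma> = val (poly p c)" "\<forall>\<gamma>>b2. newton (Q c) \<gamma> = val (poly q c)"
      using newton_large[of "P c"] newton_large[of "Q c"] pq c0 by metis
    then show ?thesis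
      by (intro exI[of _ "max b1 b2"]) (simp add: H_def pq(3) val_divide pq(1,2))
  qed
  define n where "n = degree p + degree q"
  have lip: "H c w \<le> H c u + nmult n (w - u) \<and> H c u \<le> H c w + nmult n (w - u)" if "u \<le> w" for c u w
  proof -
    let ?e = "w - u"
    note * = newton_lipschitz[OF nz(1) that, of c] newton_lipschitz[OF nz(2) that, of c]
    have "0 \<le> ?e" using that by simp
    then have "nmult (degree (P c)) ?e \<le> nmult n ?e" "nmult (degree (Q c)) ?e \<le> nmult n ?e"
      by (auto simp: n_def P_def Q_def degree_pcompose intro!: nmult_mono_left)
    then have "newton (P c) w \<le> newton (P c) u + nmult n ?e" "newton (Q c) w \<le> newton (Q c) u + nmult n ?e"
      using * by (meson add_left_mono order_trans)+
    from diff_mono[OF this(1) *(3)] diff_mono[OF *(1) this(2)] show ?thesis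
      by (simp add: H_def) (simp add: algebra_simps)
  qed
  have branch: ?thesis if br: "H c u \<le> x" "y \<le> H c w" for c u w
  proof -
    obtain \<gamma> where \<gamma>: "\<gamma> \<notin> B c" "x < H c \<gamma>" "H c \<gamma> < y"
      using lipschitz_ivp[of "H c" n, OF lip br(1) assms(3) br(2) finB] by blast
    obtain z where "z \<noteq> 0" "val z = \<gamma>" using val_surj by blast
    with \<gamma> H[of z c] show ?thesis by (intro exI[of _ "c + z"]) simp
  qed
  define e where "e = y - x"
  have e: "0 < e" using assms by (simp add: e_def)
  define l where "l = min (val a) (val b)"
  obtain \<gamma> where \<gamma>: "l - e < \<gamma>" "\<gamma> < l" "\<gamma> \<notin> B a \<union> B b"
    using interval_avoids_finite[of "B a \<union> B b" "l - e" l] finB e by auto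
  obtain c where c: "c \<noteq> 0" "val c = \<gamma>" using val_surj by blast
  have *: "c - d \<noteq> 0" "val (c - d) = \<gamma>" if "d = 0 \<or> \<gamma> < val d" for d
    using that c val_add_less[of c "- d"] by (cases "d = 0"; auto simp: val_minus)+
  have "\<gamma> < val a" "\<gamma> < val b" using \<gamma> by (auto simp: l_def)
  then have "val (ev \<phi> c) = H a \<gamma>" "val (ev \<phi> c) = H b \<gamma>"
    using *[of a] *[of b] H[of "c - a" a] H[of "c - b" b] \<gamma>(3) by auto
  \<comment> \<open>The value at \<open>c\<close> decides the route: if it is at most
    \<open>x\<close>, the interval is crossed on circles around \<open>b\<close>; if it is at least
    \<open>y\<close>, on circles around \<open>a\<close>; otherwise \<open>c\<close> itself is the
    required point.\<close>
  then consider "H b \<gamma> \<le> x" | "y \<le> H a \<gamma>" | "x < val (ev \<phi> c)" "val (ev \<phi> c) < y"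
    by force
  then show ?thesis
  proof cases
    case 1
    obtain g where "\<forall>\<gamma>>g. H b \<gamma> = val (ev \<phi> b)" using large by blast
    then have "H b (g + e) = val (ev \<phi> b)" using e by simp
    with branch[OF 1] assms show ?thesis by metis
  next
    case 2
    obtain g where "\<forall>\<gamma>>g. H a \<gamma> = val (ev \<phi> a)" using large by blast
    then have "H a (g + e) = val (ev \<phi> a)" using e by simp
    with branch[OF _ 2] assms show ?thesis by metis
  qed blast
qed

end

section \<open>Factorizations\<close>

text \<open>In a cancellative monoid a divisor is proper exactly when its cofactor is not a unit;
  this replaces \<open>properfactor\<close> by equations between products, which can be evaluated at
  a point.\<close>

lemma (in comm_monoid_cancel) irreducible_iff_prod:
  assumes "a \<in> carrier G"
  shows "irreducible G a \<longleftrightarrow>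
    a \<notin> Units G \<and> (\<forall>b\<in>carrier G. \<forall>c\<in>carrier G. a = b \<otimes> c \<longrightarrow> b \<in> Units G \<or> c \<in> Units G)"
proof
  assume irr: "irreducible G a"
  show "a \<notin> Units G \<and> (\<forall>b\<in>carrier G. \<forall>c\<in>carrier G. a = b \<otimes> c \<longrightarrow> b \<in> Units G \<or> c \<in> Units G)"
  proof (intro conjI ballI impI)
    show "a \<notin> Units G" using irr by (simp add: irreducible_def)
    fix b c assume "b \<in> carrier G" "c \<in> carrier G" "a = b \<otimes> c"
    with irr show "b \<in> Units G \<or> c \<in> Units G" by (metis irreducible_prodE)
  qed
next
  assume *: "a \<notin> Units G \<and> (\<forall>b\<in>carrier G. \<forall>c\<in>carrier G. a = b \<otimes> c \<longrightarrow> b \<in> Units G \<or> c \<in> Units G)"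
  show "irreducible G a"
  proof (rule irreducibleI)
    fix b assume b: "b \<in> carrier G" "properfactor G b a"
    then obtain c where c: "c \<in> carrier G" "a = b \<otimes> c" "\<not> a divides b"
      by (auto simp: properfactor_def factor_def)
    have "c \<notin> Units G"
    proof
      assume "c \<in> Units G"
      then have "b = a \<otimes> inv c" using b c by (simp add: m_assoc)
      with c b \<open>c \<in> Units G\<close> show False by (metis Units_inv_closed dividesI)
    qed
    with * b c show "b \<in> Units G" by blast
  qed (use * in blast)
qed

text \<open>The empty product is a unit, so each nonunit contributes at least one atom to the
  concatenated factorization.\<close>

lemma (in comm_monoid_cancel) factors_refine:
  assumes "set xs \<subseteq> carrier G - Units G"
    and "\<And>x. x \<in> set xs \<Longrightarrow> \<exists>fs. set fs \<subseteq> carrier G \<and> factors G fs x"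
  shows "\<exists>fs. set fs \<subseteq> carrier G \<and> factors G fs (foldr (\<otimes>) xs \<one>) \<and> length xs \<le> length fs"
  using assms
proof (induction xs)
  case (Cons x xs)
  then obtain fs where fs: "set fs \<subseteq> carrier G" "factors G fs (foldr (\<otimes>) xs \<one>)" "length xs \<le> length fs"
    by auto
  obtain gs where gs: "set gs \<subseteq> carrier G" "factors G gs x" using Cons.prems by force
  have "gs \<noteq> []" using gs(2) Cons.prems(1) by (auto simp: factors_def)
  then have "length (x # xs) \<le> length (gs @ fs)" using fs(3) by (cases gs) auto
  moreover have "factors G (gs @ fs) (foldr (\<otimes>) (x # xs) \<one>)"
    using factors_mult[OF gs(2) fs(2) gs(1) fs(1)] by simp
  ultimately show ?case using fs gs by (intro exI[of _ "gs @ fs"]) auto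
qed (auto simp: factors_def intro!: exI[of _ "[]"])

section \<open>Factorizations in multiplicative submonoids of a field\<close>

definition mult_submonoid :: "'a::field set \<Rightarrow> bool" where
  "mult_submonoid R \<longleftrightarrow> 1 \<in> R \<and> (\<forall>x\<in>R. \<forall>y\<in>R. x * y \<in> R)"

lemma mult_monoid_of_simps [simp]:
  "carrier (mult_monoid_of R) = R - {0}" "mult (mult_monoid_of R) = (*)" "one (mult_monoid_of R) = 1"
  by (simp_all add: mult_monoid_of_def)

lemma comm_monoid_cancel_mult_monoid_of:
  assumes "mult_submonoid R"
  shows "comm_monoid_cancel (mult_monoid_of R)"
proof -
  interpret comm_monoid "mult_monoid_of R"
    using assms by (intro comm_monoidI) (auto simp: mult_submonoid_def mult_ac)
  show ?thesis by (intro comm_monoid_cancelI comm_monoid_axioms) auto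
qed

lemma Units_mult_monoid_of:
  fixes R :: "'a::field set"
  shows "Units (mult_monoid_of R) = {x \<in> R - {0}. inverse x \<in> R}"
proof -
  have "inverse x \<in> R" if "y \<in> R" "y * x = 1" for x y :: 'a
    using that inverse_unique[of x y] by (simp add: mult.commute)
  then show ?thesis by (force simp: Units_def)
qed

lemma foldr_mult_monoid_of: "foldr (mult (mult_monoid_of R)) xs (one (mult_monoid_of R)) = prod_list xs"
  by (induction xs) simp_all

lemma irreducible_mult_monoid_of:
  assumes "mult_submonoid R" "x \<in> R - {0}"
  shows "irreducible (mult_monoid_of R) x \<longleftrightarrow> x \<notin> Units (mult_monoid_of R) \<and>
    (\<forall>y\<in>R - {0}. \<forall>z\<in>R - {0}. x = y * z \<longrightarrow> y \<in> Units (mult_monoid_of R) \<or> z \<in> Units (mult_monoid_of R))"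
proof -
  interpret comm_monoid_cancel "mult_monoid_of R"
    using assms by (intro comm_monoid_cancel_mult_monoid_of)
  show ?thesis using irreducible_iff_prod[of x] assms(2) by simp
qed

lemma lengths_mult_monoid_of:
  assumes "mult_submonoid R" "r \<in> R - {0}"
  shows "n \<in> lengths (mult_monoid_of R) r \<longleftrightarrow>
    (\<exists>fs u. length fs = n \<and> set fs \<subseteq> R - {0} \<and> (\<forall>f\<in>set fs. irreducible (mult_monoid_of R) f) \<and>
      u \<in> Units (mult_monoid_of R) \<and> prod_list fs = r * u)"
proof -
  interpret comm_monoid_cancel "mult_monoid_of R"
    using assms by (intro comm_monoid_cancel_mult_monoid_of)
  have assoc: "prod_list fs \<sim>\<^bsub>mult_monoid_of R\<^esub> r \<longleftrightarrow>
      (\<exists>u. u \<in> Units (mult_monoid_of R) \<and> prod_list fs = r * u)"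
    if "set fs \<subseteq> R - {0}" for fs
  proof -
    have "prod_list fs \<in> carrier (mult_monoid_of R)"
      using multlist_closed[of fs] that unfolding foldr_mult_monoid_of by simp
    then show ?thesis
      using associatedD2[of "prod_list fs" r] associatedI2[of _ "prod_list fs" r] assms(2) by auto
  qed
  show ?thesis
    unfolding lengths_def wfactors_def foldr_mult_monoid_of mult_monoid_of_simps(1)
    by (simp add: conj_assoc) (use assoc in \<open>metis (no_types, lifting)\<close>)
qed

section \<open>Values of rational functions\<close>

lemma ratfun_value_mult:
  assumes "ratfun_value \<phi> a y" "ratfun_value \<psi> a z"
  shows "ratfun_value (\<phi> * \<psi>) a (y * z)"
proof -
  obtain p q r s where 1: "\<phi> = Fract p q" "poly q a \<noteq> 0" "y = poly p a / poly q a"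
      "\<psi> = Fract r s" "poly s a \<noteq> 0" "z = poly r a / poly s a"
    using assms unfolding ratfun_value_def by blast
  then show ?thesis unfolding ratfun_value_def
    by (intro exI[of _ "p * r"] exI[of _ "q * s"]) simp
qed

lemma ratfun_value_inverse:
  assumes "ratfun_value \<phi> a y" "y \<noteq> 0"
  shows "ratfun_value (inverse \<phi>) a (inverse y)"
proof -
  obtain p q where 1: "\<phi> = Fract p q" "poly q a \<noteq> 0" "y = poly p a / poly q a"
    using assms unfolding ratfun_value_def by blast
  with assms(2) show ?thesis unfolding ratfun_value_def
    by (intro exI[of _ q] exI[of _ p]) simp
qed

lemma ratfun_value_const: "ratfun_value (const_ratfun d) a d"
  unfolding ratfun_value_def const_ratfun_def by (intro exI[of _ "[:d:]"] exI[of _ 1]) simp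

lemma ratfun_value_0: "ratfun_value 0 a y \<Longrightarrow> y = 0"
  using ratfun_value_unique[OF ratfun_value_const[of 0 a]] by (simp add: const_ratfun_def Zero_fract_def)

lemma const_ratfun_mult: "const_ratfun (x * y) = const_ratfun x * const_ratfun y"
  by (simp add: const_ratfun_def mult.commute)

lemma const_ratfun_1 [simp]: "const_ratfun 1 = 1"
  by (simp add: const_ratfun_def One_fract_def one_pCons)

lemma const_ratfun_0 [simp]: "const_ratfun 0 = 0"
  by (simp add: const_ratfun_def Zero_fract_def)

lemma const_ratfun_eq_0_iff [simp]: "const_ratfun x = 0 \<longleftrightarrow> x = 0"
  using ratfun_value_const[of x] ratfun_value_0 by fastforce

lemma const_ratfun_in_IntR: "const_ratfun d \<in> IntR D \<longleftrightarrow> d \<in> D"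
  using ratfun_value_const ratfun_value_unique unfolding IntR_def by blast

lemma mult_submonoid_IntR: "mult_submonoid D \<Longrightarrow> mult_submonoid (IntR D)"
  using const_ratfun_in_IntR[of 1 D] ratfun_value_mult
  unfolding mult_submonoid_def IntR_def by simp blast

lemma prod_list_const_ratfun: "prod_list (map const_ratfun xs) = const_ratfun (prod_list xs)"
  by (induction xs) (simp_all add: const_ratfun_mult)

section \<open>Integer-valued rational functions\<close>

text \<open>Describes \<open>D\<close> by its multiplication and its values; \<open>eps_gap\<close>
  isolates 0 in \<open>M\<close>.\<close>

locale gap_domain = dense_valued_field val
  for val :: "'f::field \<Rightarrow> 'g::linordered_ab_group_add" +
  fixes D :: "'f set" and M :: "'g set" and \<epsilon> :: 'g
  assumes submonoid_D: "mult_submonoid D"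
    and val_D: "x \<in> D \<Longrightarrow> x \<noteq> 0 \<Longrightarrow> val x \<in> M"
    and inverse_D: "x \<in> D \<Longrightarrow> x \<noteq> 0 \<Longrightarrow> val x = 0 \<Longrightarrow> inverse x \<in> D"
    and eps_pos: "0 < \<epsilon>"
    and eps_gap: "\<mu> \<in> M \<Longrightarrow> \<mu> = 0 \<or> \<epsilon> \<le> \<mu>"
begin

abbreviation "DM \<equiv> mult_monoid_of D"
abbreviation "RM \<equiv> mult_monoid_of (IntR D)"

lemma M_nonneg: "\<mu> \<in> M \<Longrightarrow> 0 \<le> \<mu>"
  using eps_gap eps_pos by fastforce

lemma Units_D: "x \<in> Units DM \<longleftrightarrow> x \<in> D \<and> x \<noteq> 0 \<and> val x = 0"
proof
  assume "x \<in> Units DM"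
  then have x: "x \<in> D" "x \<noteq> 0" "inverse x \<in> D" by (auto simp: Units_mult_monoid_of)
  then have "val x \<in> M" "- val x \<in> M" using val_D[of x] val_D[of "inverse x"] val_inverse by auto
  from this[THEN M_nonneg] have "0 \<le> val x" "0 \<le> - val x" .
  with x show "x \<in> D \<and> x \<noteq> 0 \<and> val x = 0" by simp
qed (auto simp: Units_mult_monoid_of inverse_D)

lemma nonunit_D: "x \<in> D \<Longrightarrow> x \<noteq> 0 \<Longrightarrow> x \<notin> Units DM \<longleftrightarrow> \<epsilon> \<le> val x"
  using eps_gap[OF val_D] eps_pos by (auto simp: Units_D)

text \<open>Nonunits have value at least \<epsilon>, so each factor in a splitting into nonunits
  loses at least \<epsilon>. The induction counts these steps, and their number is finite because
  multiples of \<epsilon> are unbounded.\<close>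

lemma factors_D:
  assumes "x \<in> D" "x \<noteq> 0" "x \<notin> Units DM"
  shows "\<exists>fs. set fs \<subseteq> carrier DM \<and> factors DM fs x"
proof -
  have "val x < nmult k \<epsilon> \<Longrightarrow> \<exists>fs. set fs \<subseteq> carrier DM \<and> factors DM fs x" for k
    using assms
  proof (induction k arbitrary: x)
    case 0
    then show ?case using M_nonneg[OF val_D[of x]] by simp
  next
    case (Suc k)
    interpret comm_monoid_cancel DM
      using submonoid_D by (rule comm_monoid_cancel_mult_monoid_of)
    show ?case
    proof (cases "irreducible DM x")
      case True
      then show ?thesis using Suc.prems by (intro exI[of _ "[x]"]) (simp add: factors_def)
    next
      case False
      then obtain y z where yz: "y \<in> D - {0}" "z \<in> D - {0}" "x = y * z" "y \<notin> Units DM" "z \<notin> Units DM"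
        using irreducible_mult_monoid_of[OF submonoid_D, of x] Suc.prems by auto
      then have v: "val x = val y + val z" "\<epsilon> \<le> val y" "\<epsilon> \<le> val z"
        using nonunit_D[of y] nonunit_D[of z] by (auto simp: val_mult)
      have "\<epsilon> + val y \<le> val x" "\<epsilon> + val z \<le> val x" using v by (auto simp: add.commute)
      with Suc.prems(1) have "val y < nmult k \<epsilon>" "val z < nmult k \<epsilon>"
        by (auto simp: nmult_Suc dest: le_less_trans)
      then obtain fs gs where "set fs \<subseteq> carrier DM" "factors DM fs y" "set gs \<subseteq> carrier DM" "factors DM gs z"
        using Suc.IH[of y] Suc.IH[of z] yz by blast
      then have "factors DM (fs @ gs) x" "set (fs @ gs) \<subseteq> carrier DM"
        using factors_mult[of fs y gs z] yz(3) by auto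
      then show ?thesis by blast
    qed
  qed
  then show ?thesis using archimedean[OF eps_pos, of "val x"] by blast
qed

text \<open>Integer-valued factors are defined everywhere, and their values multiply to a nonzero
  one. Hence all divisors of a nonzero constant are nonvanishing, which is why the valuation of
  their values can be studied at every point.\<close>

lemma nonvanishing_factor:
  assumes "nonvanishing (\<phi> * \<psi>)" "\<phi> \<in> IntR D" "\<psi> \<in> IntR D"
  shows "nonvanishing \<phi>" "nonvanishing \<psi>"
proof -
  have "\<exists>y z. y \<noteq> 0 \<and> ratfun_value \<phi> a y \<and> z \<noteq> 0 \<and> ratfun_value \<psi> a z" for a
  proof -
    obtain y z where yz: "ratfun_value \<phi> a y" "ratfun_value \<psi> a z"
      using assms(2,3) unfolding IntR_def by blast
    with assms(1) ratfun_value_unique[OF ratfun_value_mult[OF yz]] have "y * z \<noteq> 0"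
      unfolding nonvanishing_def by metis
    with yz show ?thesis by auto
  qed
  then show "nonvanishing \<phi>" "nonvanishing \<psi>" unfolding nonvanishing_def by blast+
qed

lemma nonvanishing_const: "d \<noteq> 0 \<Longrightarrow> nonvanishing (const_ratfun d)"
  using ratfun_value_const unfolding nonvanishing_def by blast

lemma ev_const: "ev (const_ratfun d) a = d"
  by (intro ev_eqI ratfun_value_const)

lemma ev_mult: "nonvanishing \<phi> \<Longrightarrow> nonvanishing \<psi> \<Longrightarrow> ev (\<phi> * \<psi>) a = ev \<phi> a * ev \<psi> a"
  by (intro ev_eqI ratfun_value_mult) (auto dest: nonvanishingD)

lemma ev_in_D: "nonvanishing \<phi> \<Longrightarrow> \<phi> \<in> IntR D \<Longrightarrow> ev \<phi> a \<in> D"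
  using ev_eqI unfolding IntR_def by blast

lemma IntR_iff: "nonvanishing \<phi> \<Longrightarrow> \<phi> \<in> IntR D \<longleftrightarrow> (\<forall>a. ev \<phi> a \<in> D)"
  using ev_in_D nonvanishingD[of \<phi>] unfolding IntR_def by blast

lemma nonvanishing_nonzero: "nonvanishing \<phi> \<Longrightarrow> \<phi> \<noteq> 0"
  using nonvanishingD[of \<phi>] ratfun_value_0 by blast

lemma nonvanishing_inverse:
  assumes "nonvanishing \<phi>"
  shows "nonvanishing (inverse \<phi>)" "ev (inverse \<phi>) a = inverse (ev \<phi> a)"
proof -
  have *: "ratfun_value (inverse \<phi>) a (inverse (ev \<phi> a))" "inverse (ev \<phi> a) \<noteq> 0" for a
    using nonvanishingD[OF assms, of a] ratfun_value_inverse by auto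
  show "nonvanishing (inverse \<phi>)" unfolding nonvanishing_def using * by blast
  show "ev (inverse \<phi>) a = inverse (ev \<phi> a)" by (intro ev_eqI *)
qed

lemma nonvanishing_mult:
  "nonvanishing \<phi> \<Longrightarrow> nonvanishing \<psi> \<Longrightarrow> nonvanishing (\<phi> * \<psi>)"
  unfolding nonvanishing_def using ratfun_value_mult no_zero_divisors by metis

lemma nonvanishing_prod_list:
  "(\<And>f. f \<in> set fs \<Longrightarrow> nonvanishing f) \<Longrightarrow>
    nonvanishing (prod_list fs) \<and> ev (prod_list fs) a = prod_list (map (\<lambda>f. ev f a) fs)"
proof (induction fs)
  case Nil
  then show ?case using nonvanishing_const[of 1] ev_const[of 1] by simp
qed (simp add: nonvanishing_mult ev_mult)

text \<open>Values on both sides of the gap would force, by \<open>ratfun_ivp\<close>, a value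
  inside it, although all values lie in \<open>M\<close>.\<close>

lemma value_gap:
  assumes "nonvanishing \<phi>" "\<phi> \<in> IntR D" "x < y" "\<not> (\<exists>\<gamma>\<in>M. x < \<gamma> \<and> \<gamma> < y)"
  shows "(\<forall>a. val (ev \<phi> a) \<le> x) \<or> (\<forall>a. y \<le> val (ev \<phi> a))"
proof (rule ccontr)
  have M: "val (ev \<phi> a) \<in> M" for a
    using val_D[OF ev_in_D[OF assms(1,2)]] nonvanishingD[OF assms(1)] by blast
  assume "\<not> ?thesis"
  then obtain a b where "\<not> val (ev \<phi> b) \<le> x" "\<not> y \<le> val (ev \<phi> a)" by blast
  with assms(4) M have "val (ev \<phi> a) \<le> x" "y \<le> val (ev \<phi> b)" by (meson not_le)+
  from ratfun_ivp[OF assms(1) this(1) assms(3) this(2)] M assms(4) show False by blast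
qed

text \<open>Being a unit can be tested at a single point, because the values of a nonvanishing
  integer-valued function cannot cross the gap between \<open>0\<close> and \<open>\<epsilon>\<close>.\<close>

lemma Units_IntR:
  assumes \<phi>: "nonvanishing \<phi>" "\<phi> \<in> IntR D"
  shows "\<phi> \<in> Units RM \<longleftrightarrow> ev \<phi> a \<in> Units DM"
proof
  assume "\<phi> \<in> Units RM"
  then have "inverse \<phi> \<in> IntR D" by (simp add: Units_mult_monoid_of)
  then have "inverse (ev \<phi> a) \<in> D"
    using ev_in_D[of "inverse \<phi>"] nonvanishing_inverse[OF \<phi>(1)] by metis
  then show "ev \<phi> a \<in> Units DM"
    using ev_in_D[OF \<phi>] nonvanishingD[OF \<phi>(1)] by (simp add: Units_mult_monoid_of)
next
  assume "ev \<phi> a \<in> Units DM"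
  then have "val (ev \<phi> a) = 0" by (simp add: Units_D)
  moreover have "\<not> (\<exists>\<gamma>\<in>M. 0 < \<gamma> \<and> \<gamma> < \<epsilon>)" using eps_gap by fastforce
  ultimately have le: "val (ev \<phi> b) \<le> 0" for b using value_gap[OF \<phi> eps_pos] eps_pos by (metis not_le)
  have D: "ev \<phi> b \<in> D" "ev \<phi> b \<noteq> 0" for b
    using ev_in_D[OF \<phi>] nonvanishingD[OF \<phi>(1)] by auto
  have "val (ev \<phi> b) = 0" for b using le[of b] M_nonneg[OF val_D[OF D, of b]] by simp
  then have "inverse (ev \<phi> b) \<in> D" for b using inverse_D D by blast
  then have "inverse \<phi> \<in> IntR D" using IntR_iff nonvanishing_inverse[OF \<phi>(1)] by simp
  then show "\<phi> \<in> Units RM"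
    using \<phi>(2) nonvanishing_nonzero[OF \<phi>(1)] by (simp add: Units_mult_monoid_of)
qed

lemma Units_const: "d \<in> D \<Longrightarrow> d \<noteq> 0 \<Longrightarrow> const_ratfun d \<in> Units RM \<longleftrightarrow> d \<in> Units DM"
  using Units_IntR[OF nonvanishing_const[of d]] by (simp add: ev_const const_ratfun_in_IntR)

lemma submonoid_IntR: "mult_submonoid (IntR D)"
  using mult_submonoid_IntR submonoid_D by blast

text \<open>Evaluation at 0 turns a splitting of the constant into one in \<open>D\<close>; the
  factor that becomes a unit there was a unit already, by \<open>Units_IntR\<close>.\<close>

lemma irreducible_const:
  assumes "d \<in> D" "d \<noteq> 0" "irreducible DM d"
  shows "irreducible RM (const_ratfun d)"
proof -
  have d: "const_ratfun d \<in> IntR D - {0}" using assms by (simp add: const_ratfun_in_IntR)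
  have "\<phi> \<in> Units RM \<or> \<psi> \<in> Units RM"
    if *: "\<phi> \<in> IntR D - {0}" "\<psi> \<in> IntR D - {0}" "const_ratfun d = \<phi> * \<psi>" for \<phi> \<psi>
  proof -
    have nv: "nonvanishing \<phi>" "nonvanishing \<psi>"
      using nonvanishing_factor[of \<phi> \<psi>] nonvanishing_const[OF assms(2)] * by auto
    then have "d = ev \<phi> 0 * ev \<psi> 0" using ev_mult[OF nv, of 0] ev_const[of d] *(3) by metis
    moreover have "ev \<phi> 0 \<in> D - {0}" "ev \<psi> 0 \<in> D - {0}"
      using nv * ev_in_D nonvanishingD by auto
    ultimately have "ev \<phi> 0 \<in> Units DM \<or> ev \<psi> 0 \<in> Units DM"
      using irreducible_mult_monoid_of[OF submonoid_D, of d] assms by blast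
    then show ?thesis using Units_IntR nv * by blast
  qed
  moreover have "const_ratfun d \<notin> Units RM"
    using assms by (simp add: Units_const irreducible_def)
  ultimately show ?thesis using irreducible_mult_monoid_of[OF submonoid_IntR d] by blast
qed

lemma lengths_D_subset:
  assumes "d \<in> D" "d \<noteq> 0"
  shows "lengths DM d \<subseteq> lengths RM (const_ratfun d)"
proof
  fix n assume "n \<in> lengths DM d"
  then obtain fs u where fs: "length fs = n" "set fs \<subseteq> D - {0}" "\<forall>f\<in>set fs. irreducible DM f"
      "u \<in> Units DM" "prod_list fs = d * u"
    using lengths_mult_monoid_of[OF submonoid_D, of d] assms by blast
  have "const_ratfun u \<in> Units RM" using fs(4) by (simp add: Units_const Units_D)
  moreover have "prod_list (map const_ratfun fs) = const_ratfun d * const_ratfun u"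
    unfolding prod_list_const_ratfun fs(5) const_ratfun_mult ..
  moreover have "set (map const_ratfun fs) \<subseteq> IntR D - {0}"
    using fs(2) by (auto simp: const_ratfun_in_IntR)
  moreover have "\<forall>f\<in>set (map const_ratfun fs). irreducible RM f"
    using fs(2,3) irreducible_const by auto
  moreover have "const_ratfun d \<in> IntR D - {0}" using assms by (simp add: const_ratfun_in_IntR)
  ultimately show "n \<in> lengths RM (const_ratfun d)"
    using lengths_mult_monoid_of[OF submonoid_IntR] fs(1) by (metis length_map)
qed

lemma nonvanishing_prod_list_factor:
  assumes "nonvanishing (prod_list gs)" "set gs \<subseteq> IntR D" "f \<in> set gs"
  shows "nonvanishing f"
proof -
  have prod_in: "prod_list gs \<in> IntR D" if "set gs \<subseteq> IntR D" for gs
    using that submonoid_IntR by (induction gs) (auto simp: mult_submonoid_def)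
  show ?thesis using assms
  proof (induction gs)
    case (Cons g gs)
    then show ?case using nonvanishing_factor[of g "prod_list gs"] prod_in[of gs] by auto
  qed simp
qed

text \<open>Evaluation at 0 sends the atoms to nonunits of \<open>D\<close> whose product is
  \<open>d\<close> up to a unit, and refining these into atoms cannot shorten the list. The
  splitting \<open>d1 * d2\<close> into nonunits rules out length 1.\<close>

lemma lengths_IntR_bounds:
  assumes d: "d = d1 * d2" "d1 \<in> D" "d2 \<in> D" "0 < val d1" "0 < val d2" "d \<noteq> 0"
    and n: "n \<in> lengths RM (const_ratfun d)"
  shows "2 \<le> n \<and> enat n \<le> max_length DM d"
proof -
  have d12: "d1 \<noteq> 0" "d2 \<noteq> 0" using d by auto
  have dD: "d \<in> D" using d submonoid_D by (auto simp: mult_submonoid_def)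
  then have cd: "const_ratfun d \<in> IntR D - {0}" using d by (simp add: const_ratfun_in_IntR)
  obtain fs u where fs: "length fs = n" "set fs \<subseteq> IntR D - {0}" "\<forall>f\<in>set fs. irreducible RM f"
      "u \<in> Units RM" "prod_list fs = const_ratfun d * u"
    using n lengths_mult_monoid_of[OF submonoid_IntR cd] by blast
  have u: "u \<in> IntR D" "inverse u \<in> IntR D" "u \<noteq> 0" using fs(4) by (auto simp: Units_mult_monoid_of)
  then have "nonvanishing (u * inverse u)" using nonvanishing_const[of 1] by simp
  then have nvu: "nonvanishing u" using nonvanishing_factor u by blast
  have u0: "ev u 0 \<in> Units DM" using Units_IntR[OF nvu u(1)] fs(4) by blast
  have nvP: "nonvanishing (prod_list fs)"
    unfolding fs(5) using d nvu by (intro nonvanishing_mult nonvanishing_const) auto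
  have nv: "nonvanishing f" if "f \<in> set fs" for f
    using nonvanishing_prod_list_factor[OF nvP _ that] fs(2) by blast
  define xs where "xs = map (\<lambda>f. ev f 0) fs"
  have "prod_list xs = ev (prod_list fs) 0"
    using nonvanishing_prod_list[of fs 0] nv by (simp add: xs_def)
  then have P: "prod_list xs = d * ev u 0"
    unfolding fs(5) ev_mult[OF nonvanishing_const[OF d(6)] nvu] ev_const .
  have xs: "set xs \<subseteq> carrier DM - Units DM"
  proof
    fix x assume "x \<in> set xs"
    then obtain f where f: "f \<in> set fs" "x = ev f 0" by (auto simp: xs_def)
    then have "f \<notin> Units RM" "f \<in> IntR D" using fs by (auto simp: irreducible_def)
    then show "x \<in> carrier DM - Units DM"
      using f nv[OF f(1)] Units_IntR[of f 0] ev_in_D nonvanishingD by auto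
  qed
  have "n \<noteq> 0"
  proof
    assume "n = 0"
    then have "d * ev u 0 = 1" using fs(1) P by (simp add: xs_def)
    moreover have "val (d * ev u 0) = val d1 + val d2"
      using d u0 d12 by (simp add: val_mult Units_D)
    ultimately show False using d add_pos_pos by (metis less_irrefl val_1)
  qed
  moreover have "n \<noteq> 1"
  proof
    assume "n = 1"
    then obtain f where f: "fs = [f]" using fs(1) by (cases fs) auto
    have irr: "irreducible RM f" "f = const_ratfun d1 * (const_ratfun d2 * u)" "f \<in> IntR D - {0}"
      using f fs d(1) by (auto simp: const_ratfun_mult)
    have c1: "const_ratfun d1 \<in> IntR D - {0}" using d d12 by (auto simp: const_ratfun_in_IntR)
    have c2: "const_ratfun d2 * u \<in> IntR D - {0}"
      using d d12 u submonoid_IntR by (auto simp: const_ratfun_in_IntR mult_submonoid_def)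
    have "const_ratfun d1 \<in> Units RM \<or> const_ratfun d2 * u \<in> Units RM"
      using irreducible_mult_monoid_of[OF submonoid_IntR irr(3)] irr c1 c2 by blast
    moreover have "const_ratfun d1 \<notin> Units RM" using d d12 by (simp add: Units_const Units_D)
    moreover have "const_ratfun d2 * u \<notin> Units RM"
    proof -
      have "ev (const_ratfun d2 * u) 0 = d2 * ev u 0"
        using ev_mult[OF nonvanishing_const nvu] d12 ev_const by simp
      moreover have "val (d2 * ev u 0) = val d2" using u0 d12 by (simp add: val_mult Units_D)
      ultimately show ?thesis
        using Units_IntR[of "const_ratfun d2 * u" 0] c2 d12 nvu d(5)
        by (auto simp: nonvanishing_mult nonvanishing_const Units_D)
    qed
    ultimately show False by blast
  qed
  ultimately have "2 \<le> n" by simp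
  interpret DM: comm_monoid_cancel DM
    using submonoid_D by (rule comm_monoid_cancel_mult_monoid_of)
  obtain gs where gs: "set gs \<subseteq> carrier DM" "factors DM gs (prod_list xs)" "length xs \<le> length gs"
    using DM.factors_refine[OF xs] xs factors_D unfolding foldr_mult_monoid_of by fastforce
  then have "prod_list gs = d * ev u 0" unfolding P factors_def foldr_mult_monoid_of by simp
  then have "length gs \<in> lengths DM d"
    using lengths_mult_monoid_of[OF submonoid_D, of d] gs(1,2) u0 dD d(6) by (auto simp: factors_def)
  then have "enat (length gs) \<le> max_length DM d" unfolding max_length_def by (rule SUP_upper)
  moreover have "n \<le> length gs" using gs(3) fs(1) by (simp add: xs_def)
  ultimately show ?thesis using \<open>2 \<le> n\<close> order_trans[of "enat n" "enat (length gs)"] by simp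
qed

lemma nonvanishing_prod:
  assumes "finite S" "\<And>i. i \<in> S \<Longrightarrow> nonvanishing (f i)"
  shows "nonvanishing (prod f S) \<and> ev (prod f S) a = (\<Prod>i\<in>S. ev (f i) a)"
  using assms
proof (induction S rule: finite_induct)
  case empty
  then show ?case using nonvanishing_const[of 1] ev_const[of 1] by simp
qed (simp add: nonvanishing_mult ev_mult)

end

section \<open>Bump functions\<close>

text \<open>\<open>large_D\<close> carries integral terminality over to \<open>D\<close>. The
  threshold \<delta> may have either sign; at 0 the truncation takes effect as if the value of 0
  were infinite.\<close>

locale bump_domain = gap_domain val D M \<epsilon>
  for val :: "'f::field \<Rightarrow> 'g::linordered_ab_group_add" and D M \<epsilon> +
  fixes \<alpha> \<beta> \<delta> :: 'g and h :: "'f poly" and m :: nat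
  assumes large_D: "x \<noteq> 0 \<Longrightarrow> \<alpha> < val x \<Longrightarrow> x \<in> D"
    and beta: "0 < \<beta>" "\<beta> < \<alpha>" "\<not> (\<exists>\<gamma>\<in>M. \<beta> < \<gamma> \<and> \<gamma> < \<alpha>)"
    and m_pos: "0 < m"
    and h_nz: "poly h a \<noteq> 0"
    and val_h: "val (poly h a) = (if a = 0 then \<delta> else min (nmult m (val a)) \<delta>)"
begin

text \<open>By \<open>value_gap\<close> a factor stays at most \<beta> everywhere or at least
  \<alpha> everywhere. Two low factors would keep the product at most 2 \<beta>; a high factor times
  a nonunit would keep it at least \<alpha> + \<epsilon>.\<close>

lemma irreducible_criterion:
  assumes \<phi>: "nonvanishing \<phi>" "\<phi> \<in> IntR D"
    and low: "val (ev \<phi> a) < \<alpha> + \<epsilon>" and high: "\<beta> + \<beta> < val (ev \<phi> b)"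
  shows "irreducible RM \<phi>"
proof -
  have nu: "\<phi> \<notin> Units RM"
    using Units_IntR[OF \<phi>, of b] high add_strict_mono[OF beta(1) beta(1)] by (auto simp: Units_D)
  have False
    if *: "\<psi> \<in> IntR D - {0}" "\<chi> \<in> IntR D - {0}" "\<phi> = \<psi> * \<chi>" "\<psi> \<notin> Units RM" "\<chi> \<notin> Units RM" for \<psi> \<chi>
  proof -
    have nv: "nonvanishing \<psi>" "nonvanishing \<chi>"
      using nonvanishing_factor[of \<psi> \<chi>] \<phi>(1) * by auto
    have v: "val (ev \<phi> c) = val (ev \<psi> c) + val (ev \<chi> c)" for c
      using nonvanishingD[OF nv(1)] nonvanishingD[OF nv(2)] *(3) by (simp add: ev_mult nv val_mult)
    have "ev \<psi> c \<notin> Units DM" "ev \<chi> c \<notin> Units DM" for c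
      using Units_IntR[of \<psi> c] Units_IntR[of \<chi> c] nv * by auto
    then have e: "\<epsilon> \<le> val (ev \<psi> c)" "\<epsilon> \<le> val (ev \<chi> c)" for c
      using nonunit_D[of "ev \<psi> c"] nonunit_D[of "ev \<chi> c"] nv * ev_in_D nonvanishingD by auto
    consider "\<forall>c. val (ev \<psi> c) \<le> \<beta>" "\<forall>c. val (ev \<chi> c) \<le> \<beta>" | "\<forall>c. \<alpha> \<le> val (ev \<psi> c)" | "\<forall>c. \<alpha> \<le> val (ev \<chi> c)"
      using value_gap[OF nv(1) _ beta(2,3)] value_gap[OF nv(2) _ beta(2,3)] * by blast
    then show False
    proof cases
      case 1
      then have "val (ev \<phi> b) \<le> \<beta> + \<beta>" unfolding v by (intro add_mono) auto
      with high show False by simp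
    next
      case 2
      then have "\<alpha> + \<epsilon> \<le> val (ev \<phi> a)" unfolding v using e by (intro add_mono) auto
      with low show False by simp
    next
      case 3
      then have "\<epsilon> + \<alpha> \<le> val (ev \<phi> a)" unfolding v using e by (intro add_mono) auto
      with low show False by (simp add: add.commute)
    qed
  qed
  then show ?thesis using irreducible_mult_monoid_of[OF submonoid_IntR, of \<phi>] \<phi> nu nonvanishing_nonzero by blast
qed

text \<open>With g = m v(x - z) and v(e) = - \<kappa>, dilation by \<open>e\<close> and division by
  \<open>e ^ m\<close> move the truncation of g from \<delta> to \<delta> + m \<kappa>. Dividing by
  h(x - z) leaves min g (\<delta> + m \<kappa>) - min g \<delta>, a bump of height m \<kappa>
  supported on the disc g > \<delta>.\<close>

definition bump :: "'f \<Rightarrow> 'f \<Rightarrow> 'f poly fract" where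
  "bump e z = Fract (smult (inverse (e ^ m)) (pcompose h [:- z * e, e:])) (pcompose h [:- z, 1:])"

lemma bump_value:
  assumes "e \<noteq> 0"
  shows "nonvanishing (bump e z)"
    and "ev (bump e z) a = poly h ((a - z) * e) / (e ^ m * poly h (a - z))"
proof -
  have *: "ratfun_value (bump e z) a (poly h ((a - z) * e) / (e ^ m * poly h (a - z)))" for a
    unfolding ratfun_value_def bump_def
    by (intro exI conjI, rule refl) (simp_all add: poly_pcompose h_nz algebra_simps divide_inverse)
  show "ev (bump e z) a = poly h ((a - z) * e) / (e ^ m * poly h (a - z))"
    by (intro ev_eqI *)
  show "nonvanishing (bump e z)"
    unfolding nonvanishing_def using * h_nz assms by (metis divide_eq_0_iff mult_eq_0_iff power_not_zero)
qed

lemma val_bump: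
  assumes e: "e \<noteq> 0" "val e = - \<kappa>" "0 < \<kappa>"
  shows "0 \<le> val (ev (bump e z) a)" "val (ev (bump e z) a) \<le> nmult m \<kappa>"
    and "val (ev (bump e z) z) = nmult m \<kappa>"
    and "a \<noteq> z \<Longrightarrow> nmult m (val (a - z)) \<le> \<delta> \<Longrightarrow> val (ev (bump e z) a) = 0"
proof -
  let ?k = "nmult m \<kappa>"
  have k: "0 < ?k" using e m_pos nmult_pos by blast
  have v: "val (ev (bump e z) a) = val (poly h ((a - z) * e)) + ?k - val (poly h (a - z))" for a
    using e by (simp add: bump_value val_divide val_mult h_nz val_power nmult_minus algebra_simps)
  show z: "val (ev (bump e z) z) = ?k" using v[of z] by (simp add: val_h)
  have "0 \<le> val (ev (bump e z) a) \<and> val (ev (bump e z) a) \<le> ?k \<and>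
    (nmult m (val (a - z)) \<le> \<delta> \<longrightarrow> val (ev (bump e z) a) = 0)" if "a \<noteq> z"
  proof -
    let ?g = "nmult m (val (a - z))"
    have "val (ev (bump e z) a) = min (?g - ?k) \<delta> + ?k - min ?g \<delta>"
      unfolding v val_h using that e by (simp add: val_mult nmult_diff nmult_minus nmult_add_right)
    also have "min (?g - ?k) \<delta> + ?k = min ?g (\<delta> + ?k)" by (simp add: min_add_distrib_left)
    finally show ?thesis using k by (auto simp: min_def diff_le_eq add.commute add_increasing2)
  qed
  then show "0 \<le> val (ev (bump e z) a)" "val (ev (bump e z) a) \<le> ?k"
    "a \<noteq> z \<Longrightarrow> nmult m (val (a - z)) \<le> \<delta> \<Longrightarrow> val (ev (bump e z) a) = 0"
    using z k by (cases "a = z"; auto)+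
qed

text \<open>Points of rapidly decreasing value: the difference of two has the value of the later
  one, which is low enough to put each point outside the disc of every other.\<close>

lemma separated_points:
  obtains z :: "nat \<Rightarrow> 'f" where "\<And>i j. i \<noteq> j \<Longrightarrow> z i \<noteq> z j \<and> nmult m (val (z i - z j)) \<le> \<delta>"
proof -
  obtain N where N: "- \<delta> < nmult N \<epsilon>" using archimedean[OF eps_pos] by blast
  \<comment> \<open>A multiple of \<epsilon> this large gives - m \<rho> \<le> \<delta> even for
    negative \<delta>; the successor keeps \<rho> positive when \<open>N\<close> is 0.\<close>
  define \<rho> where "\<rho> = nmult (Suc N) \<epsilon>"
  have \<rho>: "0 < \<rho>" unfolding \<rho>_def using eps_pos by (intro nmult_pos) auto
  have "nmult N \<epsilon> \<le> nmult m \<rho>"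
    unfolding \<rho>_def nmult_mult[symmetric] using m_pos eps_pos
    by (intro nmult_mono_left) (auto simp: trans_le_add1 gr0_conv_Suc)
  with N have md: "- nmult m \<rho> \<le> \<delta>" by (simp add: minus_le_iff)
  have "\<forall>i. \<exists>x. x \<noteq> 0 \<and> val x = - nmult (Suc i) \<rho>" using val_surj by blast
  then obtain z where z: "\<And>i::nat. z i \<noteq> 0" "\<And>i. val (z i) = - nmult (Suc i) \<rho>" by metis
  have *: "z i \<noteq> z j \<and> nmult m (val (z i - z j)) \<le> \<delta>" if "i < j" for i j
  proof -
    have "nmult (Suc i) \<rho> < nmult (Suc j) \<rho>"
      using that \<rho> nmult_pos[OF \<rho>, of "j - i"] nmult_add[of "Suc i" "j - i" \<rho>] by simp
    then have "val (- z j) < val (z i)" using z by (simp add: val_minus)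
    from val_add_less[OF _ z(1) this] have *: "z i - z j \<noteq> 0" "val (z i - z j) = val (z j)"
      using z(1) by (auto simp: val_minus)
    have "nmult 1 \<rho> \<le> nmult (Suc j) \<rho>" using \<rho> by (intro nmult_mono_left) auto
    then have "nmult m (val (z i - z j)) \<le> nmult m (- \<rho>)"
      unfolding * z(2) by (intro nmult_mono) simp
    with md * show ?thesis by (simp add: nmult_minus)
  qed
  have "z i \<noteq> z j \<and> nmult m (val (z i - z j)) \<le> \<delta>" if "i \<noteq> j" for i j
  proof (cases "i < j")
    case False
    with *[of j i] that val_minus[of "z i - z j"] show ?thesis by auto
  qed (rule *)
  then show ?thesis using that by blast
qed

text \<open>Distribute \<open>d\<close> over \<open>n - 1\<close> bumps supported on disjoint discs and the complementary
  factor, all normalized to have minimal value slightly above \<open>\<alpha>\<close>.\<close>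

lemma lengths_IntR_constructed:
  assumes "2 \<le> n" "d \<noteq> 0" "nmult (Suc n) \<alpha> \<le> val d"
  shows "n \<in> lengths RM (const_ratfun d)"
proof -
  obtain j where j: "n = Suc j" "0 < j" using assms(1) by (cases n) auto
  have ab: "0 < \<alpha> - \<beta>" using beta by simp
  then have "0 < min \<epsilon> (\<alpha> - \<beta>)" using eps_pos by simp
  \<comment> \<open>\<eta> is the excess of the base values over \<alpha>. It stays below \<epsilon>
    for the low side of \<open>irreducible_criterion\<close>, and n copies of it stay below \<alpha>
    - \<beta> for the budget of the last factor.\<close>
  then obtain \<eta> where \<eta>: "0 < \<eta>" "nmult n \<eta> < min \<epsilon> (\<alpha> - \<beta>)" using small_multiple by blast
  have \<eta>n: "\<eta> + nmult j \<eta> < \<alpha> - \<beta>" "nmult 1 \<eta> \<le> nmult n \<eta>" "0 \<le> nmult j \<eta>"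
    using \<eta> nmult_mono_left[of \<eta> 1 n] j nmult_nonneg[of \<eta> j] by (auto simp: nmult_Suc)
  then have \<eta>\<epsilon>: "\<eta> < \<epsilon>" using \<eta> by (auto intro: le_less_trans)
  have d\<alpha>: "\<alpha> + (\<alpha> + nmult j \<alpha>) \<le> val d" using assms(3) j by (simp add: nmult_Suc)
  \<comment> \<open>What remains for the last factor. As \<open>Suc n\<close> is j + 2, this is at
    least 2 \<alpha> - j \<eta>, which exceeds \<alpha> + \<beta> + \<eta> by the choice of
    \<eta>.\<close>
  define V where "V = val d - nmult j (\<alpha> + \<eta>)"
  have "\<alpha> + \<alpha> - nmult j \<eta> \<le> V"
    using d\<alpha> by (simp add: V_def nmult_add_right algebra_simps)
  then have "\<alpha> + \<alpha> \<le> V + nmult j \<eta>" by (simp add: algebra_simps)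
  moreover have "\<alpha> + (\<beta> + (\<eta> + nmult j \<eta>)) < \<alpha> + \<alpha>" using \<eta>n(1) by (simp add: algebra_simps)
  ultimately have "\<alpha> + (\<beta> + (\<eta> + nmult j \<eta>)) < V + nmult j \<eta>" by (rule less_le_trans[rotated])
  then have "(\<alpha> + \<beta> + \<eta>) + nmult j \<eta> < V + nmult j \<eta>" by (simp only: add.assoc)
  then have V2: "\<alpha> + \<beta> + \<eta> < V" by (simp only: add_less_cancel_right)
  have V: "\<beta> + \<beta> < V" "0 \<le> V - \<alpha> - \<eta>" "V - \<alpha> - \<eta> < V - \<alpha>"
  proof -
    have "\<beta> + \<beta> < \<alpha> + \<beta>" using beta by simp
    also have "\<dots> < \<alpha> + \<beta> + \<eta>" using \<eta> by simp
    finally show "\<beta> + \<beta> < V" using V2 by (rule less_trans)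
    have "0 < \<beta>" by (rule beta)
    also have "\<beta> < V - \<alpha> - \<eta>" using V2 by (simp add: algebra_simps)
    finally show "0 \<le> V - \<alpha> - \<eta>" by simp
  qed (use \<eta> in simp)
  \<comment> \<open>At a bump centre the last factor has value V - m \<kappa>: the upper bound on
    \<kappa> keeps this above \<alpha>, hence in \<open>D\<close>; the lower bound brings it below
    \<alpha> + \<eta> and lifts the other factors above V, hence above 2 \<beta>.\<close>
  obtain \<kappa> where \<kappa>: "0 < \<kappa>" "V - \<alpha> - \<eta> < nmult m \<kappa>" "nmult m \<kappa> < V - \<alpha>"
    using multiples_dense[OF V(2,3) m_pos] by blast
  let ?k = "nmult m \<kappa>"
  obtain e where e: "e \<noteq> 0" "val e = - \<kappa>" using val_surj by blast
  obtain c where c: "c \<noteq> 0" "val c = \<alpha> + \<eta>" using val_surj by blast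
  obtain z :: "nat \<Rightarrow> 'f" where z: "\<And>i l. i \<noteq> l \<Longrightarrow> z i \<noteq> z l \<and> nmult m (val (z i - z l)) \<le> \<delta>"
    using separated_points by blast
  define A where "A i = bump e (z i)" for i
  define w where "w i a = val (ev (A i) a)" for i a
  have A: "nonvanishing (A i)" for i unfolding A_def using bump_value e by blast
  have w: "0 \<le> w i a" "w i a \<le> ?k" "w i (z i) = ?k" "i \<noteq> l \<Longrightarrow> w i (z l) = 0" for i l a
    unfolding w_def A_def using val_bump[OF e \<kappa>(1)] z by auto
  have disjoint: "w i a = 0 \<or> w l a = 0" if "i \<noteq> l" for i l a
  proof (rule ccontr)
    assume *: "\<not> (w i a = 0 \<or> w l a = 0)"
    have far: "a = z i \<or> \<delta> < nmult m (val (a - z i))" if "w i a \<noteq> 0" for i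
      using val_bump(4)[OF e \<kappa>(1), of a "z i"] that unfolding w_def A_def by (meson not_le)
    have "a \<noteq> z i" "a \<noteq> z l" using * w(4) that by auto
    with * far have \<delta>: "\<delta> < nmult m (val (a - z i))" "\<delta> < nmult m (val (a - z l))" by blast+
    \<comment> \<open>Ultrametric inequality: a point in both discs would put one centre into the
      disc of the other.\<close>
    have "min (val (a - z l)) (val (a - z i)) \<le> val (z i - z l)"
      using val_add[of "a - z l" "z i - a"] z[OF that] \<open>a \<noteq> z i\<close> \<open>a \<noteq> z l\<close> val_minus[of "a - z i"] by simp
    then have "\<delta> < nmult m (val (z i - z l))"
      using \<delta> nmult_mono[of "val (a - z l)" "val (z i - z l)" m] nmult_mono[of "val (a - z i)" "val (z i - z l)" m]
      by (auto simp: min_le_iff_disj)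
    with z[OF that] show False by (simp add: not_le[symmetric])
  qed
  have sum_w: "0 \<le> (\<Sum>i<j. w i a) \<and> (\<Sum>i<j. w i a) \<le> ?k" for a
  proof (cases "\<exists>i<j. w i a \<noteq> 0")
    case True
    then obtain i where i: "i < j" "w i a \<noteq> 0" by blast
    have "(\<Sum>i<j. w i a) = w i a + (\<Sum>l\<in>{..<j} - {i}. w l a)" using i by (simp add: sum.remove)
    also have "(\<Sum>l\<in>{..<j} - {i}. w l a) = 0" using disjoint i by (intro sum.neutral) auto
    finally show ?thesis using w by simp
  next
    case False
    then have "(\<Sum>i<j. w i a) = 0" by (intro sum.neutral) auto
    then show ?thesis using \<kappa> m_pos nmult_nonneg[of \<kappa> m] by simp
  qed
  define P where "P = (\<Prod>i<j. A i)"
  have P: "nonvanishing P" "ev P a = (\<Prod>i<j. ev (A i) a)" for a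
    unfolding P_def using nonvanishing_prod[of "{..<j}" A] A by auto
  have valP: "val (ev P a) = (\<Sum>i<j. w i a)" for a
    unfolding P w_def using nonvanishingD[OF A] by (intro val_prod) auto
  \<comment> \<open>\<open>c\<close> lifts each bump to base value \<alpha> + \<eta>;
    \<open>r\<close> makes the constants multiply to \<open>d\<close>, and the inverse of
    \<open>P\<close> cancels the bumps.\<close>
  define \<phi> where "\<phi> i = const_ratfun c * A i" for i
  define r where "r = d / c ^ j"
  define \<psi> where "\<psi> = const_ratfun r * inverse P"
  have \<phi>: "nonvanishing (\<phi> i)" "val (ev (\<phi> i) a) = \<alpha> + \<eta> + w i a" for i a
    using c A[of i] nonvanishing_const[of c] nonvanishingD[OF A[of i]]
    by (simp_all add: \<phi>_def nonvanishing_mult ev_mult ev_const val_mult w_def)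
  have r: "r \<noteq> 0" "val r = V"
    using assms(2) c by (simp_all add: r_def val_divide val_power V_def)
  have \<psi>: "nonvanishing \<psi>" "val (ev \<psi> a) = V - (\<Sum>i<j. w i a)" for a
    using nonvanishing_const[OF r(1)] nonvanishing_inverse[OF P(1)] nonvanishingD[OF P(1), of a] r
    by (simp_all add: \<psi>_def nonvanishing_mult ev_mult ev_const val_mult val_inverse valP)
  have \<phi>_in: "\<phi> i \<in> IntR D" for i
    unfolding IntR_iff[OF \<phi>(1)] using w \<eta> nonvanishingD[OF \<phi>(1)]
    by (auto intro!: large_D simp: \<phi>(2) add.assoc add_pos_nonneg)
  have "\<alpha> < V - (\<Sum>i<j. w i a)" for a
  proof -
    have "\<alpha> < V - ?k" using \<kappa>(3) by (simp add: algebra_simps)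
    also have "\<dots> \<le> V - (\<Sum>i<j. w i a)" using sum_w[of a] by simp
    finally show ?thesis .
  qed
  then have \<psi>_in: "\<psi> \<in> IntR D"
    unfolding IntR_iff[OF \<psi>(1)] using nonvanishingD[OF \<psi>(1)] by (auto intro!: large_D simp: \<psi>(2))
  have "irreducible RM (\<phi> i)" for i
  proof (rule irreducible_criterion[OF \<phi>(1) \<phi>_in])
    show "val (ev (\<phi> i) (z (Suc i))) < \<alpha> + \<epsilon>" using w(4)[of i "Suc i"] \<eta>\<epsilon> by (simp add: \<phi>)
    show "\<beta> + \<beta> < val (ev (\<phi> i) (z i))" using \<kappa>(2) V(1) by (simp add: \<phi> w algebra_simps)
  qed
  moreover have "irreducible RM \<psi>"
  proof (rule irreducible_criterion[OF \<psi>(1) \<psi>_in])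
    have "(\<Sum>i<j. w i (z 0)) = w 0 (z 0) + (\<Sum>l\<in>{..<j} - {0}. w l (z 0))" using j by (simp add: sum.remove)
    also have "(\<Sum>l\<in>{..<j} - {0}. w l (z 0)) = 0" using w(4) by (intro sum.neutral) auto
    finally have "(\<Sum>i<j. w i (z 0)) = ?k" using w by simp
    then have "val (ev \<psi> (z 0)) = V - ?k" by (simp add: \<psi>)
    also have "\<dots> < \<alpha> + \<eta>" using \<kappa>(2) by (simp add: algebra_simps)
    also have "\<dots> < \<alpha> + \<epsilon>" using \<eta>\<epsilon> by simp
    finally show "val (ev \<psi> (z 0)) < \<alpha> + \<epsilon>" .
    \<comment> \<open>Only the centres with index below \<open>j\<close> carry a bump, so the last
      factor has its full value V at \<open>z j\<close>.\<close>
    have "(\<Sum>i<j. w i (z j)) = 0" using w(4) by (intro sum.neutral) auto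
    then show "\<beta> + \<beta> < val (ev \<psi> (z j))" using V by (simp add: \<psi>)
  qed
  moreover have "prod_list (map \<phi> [0..<j] @ [\<psi>]) = const_ratfun d * 1"
  proof -
    have cp: "const_ratfun (c ^ i) = const_ratfun c ^ i" for i
      by (induction i) (simp_all add: const_ratfun_mult)
    have "prod_list (map \<phi> [0..<j]) = (\<Prod>i<j. \<phi> i)"
      using prod.distinct_set_conv_list[of "[0..<j]" \<phi>] by (simp add: atLeast0LessThan)
    also have "\<dots> = const_ratfun (c ^ j) * P"
      by (simp add: \<phi>_def prod.distrib P_def cp)
    finally have "prod_list (map \<phi> [0..<j] @ [\<psi>]) = const_ratfun (c ^ j * r) * (P * inverse P)"
      by (simp only: prod_list.append prod_list.Cons prod_list.Nil \<psi>_def const_ratfun_mult mult_ac mult_1_left mult_1_right)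
    also have "c ^ j * r = d" using c by (simp add: r_def)
    also have "P * inverse P = 1" using nonvanishing_nonzero[OF P(1)] by simp
    finally show ?thesis .
  qed
  moreover have "set (map \<phi> [0..<j] @ [\<psi>]) \<subseteq> IntR D - {0}"
    using \<phi>_in \<psi>_in nonvanishing_nonzero[OF \<phi>(1)] nonvanishing_nonzero[OF \<psi>(1)] by auto
  moreover have "1 \<in> Units RM" using submonoid_IntR by (simp add: Units_mult_monoid_of mult_submonoid_def)
  moreover have "const_ratfun d \<in> IntR D - {0}"
  proof -
    have "0 < \<alpha>" using beta by simp
    then have "\<alpha> < \<alpha> + (\<alpha> + nmult j \<alpha>)" using nmult_nonneg[of \<alpha> j] by (simp add: add_pos_nonneg)
    from less_le_trans[OF this d\<alpha>] have "\<alpha> < val d" .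
    then show ?thesis using assms(2) large_D by (simp add: const_ratfun_in_IntR)
  qed
  ultimately show ?thesis
    unfolding lengths_mult_monoid_of[OF submonoid_IntR \<open>const_ratfun d \<in> IntR D - {0}\<close>]
    using j by (intro exI[of _ "map \<phi> [0..<j] @ [\<psi>]"] exI[of _ 1]) auto
qed

end

section \<open>The monoid valuation\<close>

abbreviation (input) "keys \<equiv> Poly_Mapping.keys"
abbreviation (input) "lookup \<equiv> Poly_Mapping.lookup"

text \<open>With the whole group as monoid every fraction is admissible, so the valuation laws need
  no reference to \<open>M\<close>.\<close>

definition val :: "('g::linordered_ab_group_add \<Rightarrow>\<^sub>0 'k::field) fract \<Rightarrow> 'g" where
  "val = M_valuation UNIV"

lemma val_Fract: "f \<noteq> 0 \<Longrightarrow> h \<noteq> 0 \<Longrightarrow> val (Fract f h) = Min (keys f) - Min (keys h)"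
  unfolding val_def by (rule M_valuation_Fract) auto

lemma keys_nonempty: "f \<noteq> 0 \<Longrightarrow> keys f \<noteq> {}"
  by simp

lemma Fract_nonzero_cases:
  fixes x :: "'a::idom fract"
  assumes "x \<noteq> 0"
  obtains f h where "x = Fract f h" "f \<noteq> 0" "h \<noteq> 0"
proof -
  obtain f h where *: "x = Fract f h" "h \<noteq> 0" by (cases x) auto
  with assms have "f \<noteq> 0" by (auto simp: fract_collapse)
  with * that show ?thesis by blast
qed

lemma Fract_neq_0: "f \<noteq> 0 \<Longrightarrow> h \<noteq> 0 \<Longrightarrow> Fract f h \<noteq> 0"
  by (simp add: Zero_fract_def eq_fract)

lemma single_nonzero: "c \<noteq> 0 \<Longrightarrow> Poly_Mapping.single a c \<noteq> 0"
  by (metis lookup_single_eq lookup_zero)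

lemma lookup_single_mult:
  fixes f :: "'g::linordered_ab_group_add \<Rightarrow>\<^sub>0 'k::field"
  shows "lookup (Poly_Mapping.single a c * f) b = c * lookup f (b - a)"
proof -
  have inner: "(\<Sum>q. lookup f q when b = l + q) = lookup f (b - l)" for l
  proof -
    have "(\<lambda>q. lookup f q when b = l + q) = (\<lambda>q. lookup f q when q = b - l)"
      by (rule ext, rule when_cong) (auto simp: algebra_simps)
    then show ?thesis by (simp only: Sum_any_when_equal)
  qed
  have "lookup (Poly_Mapping.single a c) l * lookup f (b - l) = (c * lookup f (b - l) when l = a)" for l
    by (auto simp: lookup_single when_def)
  then show ?thesis by (simp add: lookup_mult inner)
qed

text \<open>Multiplying numerator and denominator by a common t^\<mu> moves all exponents into
  \<open>M\<close> without changing the difference of the minima.\<close>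

lemma M_valuation_eq_val:
  fixes x :: "('g::linordered_ab_group_add \<Rightarrow>\<^sub>0 'k::field) fract"
  assumes "is_submonoid M" "gp M = UNIV" "x \<noteq> 0"
  shows "M_valuation M x = val x"
proof -
  obtain f h where x: "x = Fract f h" "f \<noteq> 0" "h \<noteq> 0" using Fract_nonzero_cases[OF assms(3)] .
  obtain \<mu> where \<mu>: "\<forall>s\<in>keys f \<union> keys h. \<mu> + s \<in> M"
    using gp_common_shift[OF assms(1,2), of "keys f \<union> keys h"] by auto
  define m :: "'g \<Rightarrow>\<^sub>0 'k" where "m = Poly_Mapping.single \<mu> 1"
  have m: "m \<noteq> 0" by (simp add: m_def single_nonzero)
  have k: "keys (m * f) \<subseteq> M" "keys (m * h) \<subseteq> M"
    using keys_mult[of m f] keys_mult[of m h] \<mu> by (auto simp: m_def)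
  have "x = Fract (m * f) (m * h)" using x m by (simp add: eq_fract mult_ac)
  then have "M_valuation M x = Min (keys (m * f)) - Min (keys (m * h))"
    using M_valuation_Fract[OF k] x m by simp
  with x m show ?thesis by (simp add: Min_keys_mult val_Fract)
qed

interpretation val: valued_field "val :: ('g::linordered_ab_group_add \<Rightarrow>\<^sub>0 'k::field) fract \<Rightarrow> 'g"
proof
  fix x y :: "('g \<Rightarrow>\<^sub>0 'k) fract"
  assume "x \<noteq> 0" "y \<noteq> 0"
  then obtain f h f' h' where *: "x = Fract f h" "f \<noteq> 0" "h \<noteq> 0" "y = Fract f' h'" "f' \<noteq> 0" "h' \<noteq> 0"
    using Fract_nonzero_cases by metis
  then show "val (x * y) = val x + val y" by (simp add: val_Fract Min_keys_mult)
  assume "x + y \<noteq> 0"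
  have s: "x + y = Fract (f * h' + f' * h) (h * h')" using * by simp
  then have nz: "f * h' + f' * h \<noteq> 0" using \<open>x + y \<noteq> 0\<close> by (auto simp: fract_collapse)
  have "Min (keys (f * h' + f' * h)) \<in> keys (f * h') \<union> keys (f' * h)"
    by (rule subsetD[OF Poly_Mapping.keys_add Min_in[OF finite_keys keys_nonempty[OF nz]]])
  then have "Min (keys (f * h')) \<le> Min (keys (f * h' + f' * h)) \<or> Min (keys (f' * h)) \<le> Min (keys (f * h' + f' * h))"
    by (auto intro: Min_le)
  moreover have "val x = Min (keys (f * h')) - Min (keys (h * h'))"
      "val y = Min (keys (f' * h)) - Min (keys (h * h'))"
    using * by (simp_all add: val_Fract Min_keys_mult)
  moreover have "val (x + y) = Min (keys (f * h' + f' * h)) - Min (keys (h * h'))"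
    unfolding s using * nz by (simp add: val_Fract)
  ultimately show "min (val x) (val y) \<le> val (x + y)"
    by (auto simp: min_le_iff_disj intro: diff_right_mono)
next
  fix \<gamma> :: 'g
  have "val (Fract (Poly_Mapping.single \<gamma> 1) 1 :: ('g \<Rightarrow>\<^sub>0 'k) fract) = \<gamma>"
    by (simp add: val_Fract single_nonzero)
  moreover have "(Fract (Poly_Mapping.single \<gamma> 1) 1 :: ('g \<Rightarrow>\<^sub>0 'k) fract) \<noteq> 0"
    by (simp add: Fract_neq_0 single_nonzero)
  ultimately show "\<exists>x :: ('g \<Rightarrow>\<^sub>0 'k) fract. x \<noteq> 0 \<and> val x = \<gamma>" by blast
qed

section \<open>The localization\<close>

lemma Units_add_monoid_of:
  fixes M :: "'g::linordered_ab_group_add set"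
  assumes "is_submonoid M" "positive M"
  shows "Units (add_monoid_of M) = {0}"
proof -
  have zero: "x = 0" if "x \<in> M" "y \<in> M" "y + x = 0" for x y
  proof -
    have "0 \<le> y" "0 \<le> x" using that(1,2) assms(2) unfolding positive_def by blast+
    with that(3) show ?thesis by (simp only: add_nonneg_eq_0_iff)
  qed
  have Units: "Units (add_monoid_of M) = {x \<in> M. \<exists>y\<in>M. y + x = 0 \<and> x + y = 0}"
    by (simp add: Units_def add_monoid_of_def)
  show ?thesis
  proof (intro equalityI subsetI)
    fix x :: 'g assume "x \<in> {0}"
    with assms(1) show "x \<in> Units (add_monoid_of M)"
      unfolding Units is_submonoid_def by (intro CollectI conjI bexI[of _ 0]) auto
  qed (use zero in \<open>unfold Units, blast\<close>)
qed

text \<open>In a positive monoid 0 is the only unit, so all other monomials are generators; no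
  product of one of them with a ring element has a constant term. The denominators of the
  localization are thus those with nonzero constant term.\<close>

lemma tM_ideal_eq:
  assumes M: "is_submonoid M" "positive M"
  shows "tM_ideal M = {f \<in> carrier (monoid_ring M :: ('g::linordered_ab_group_add \<Rightarrow>\<^sub>0 'k::field) ring). 0 \<notin> keys f}"
    (is "_ = ?I")
proof
  let ?R = "monoid_ring M :: ('g \<Rightarrow>\<^sub>0 'k) ring"
  let ?S = "{Poly_Mapping.single \<alpha> 1 | \<alpha>. \<alpha> \<in> M \<and> \<alpha> \<noteq> 0 \<and> \<alpha> \<notin> Units (add_monoid_of M)} :: ('g \<Rightarrow>\<^sub>0 'k) set"
  interpret cring ?R by (rule cring_monoid_ring[OF M(1)])
  have inv: "\<ominus>\<^bsub>?R\<^esub> f = - f" if "f \<in> carrier ?R" for f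
    using that by (intro minus_equality) (auto simp: monoid_ring_def)
  have mem: "f * h \<in> ?I" if "f \<in> ?I" "h \<in> carrier ?R" for f h
  proof -
    have "0 \<notin> keys (f * h)"
    proof
      assume "0 \<in> keys (f * h)"
      then obtain u w where "u \<in> keys f" "w \<in> keys h" "0 = u + w" using keys_mult[of f h] by blast
      moreover from this that have "0 \<le> u" "0 \<le> w" "u \<noteq> 0"
        using M(2) by (auto simp: positive_def monoid_ring_def)
      ultimately show False by (simp add: add_nonneg_eq_0_iff)
    qed
    with that keys_mult_submonoid[OF M(1)] show ?thesis by (auto simp: monoid_ring_def)
  qed
  have "ideal ?I ?R"
  proof (rule idealI)
    show "subgroup ?I (add_monoid ?R)"
    proof (rule add.subgroupI)
      show "?I \<noteq> {}" by (auto intro!: exI[of _ 0] simp: monoid_ring_def)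
      show "\<ominus>\<^bsub>?R\<^esub> a \<in> ?I" if "a \<in> ?I" for a
        using that inv[of a] by (auto simp: monoid_ring_def)
      show "a \<oplus>\<^bsub>?R\<^esub> b \<in> ?I" if "a \<in> ?I" "b \<in> ?I" for a b
        using that Poly_Mapping.keys_add[of a b] by (auto simp: monoid_ring_def)
    qed auto
    show "x \<otimes>\<^bsub>?R\<^esub> a \<in> ?I" "a \<otimes>\<^bsub>?R\<^esub> x \<in> ?I" if "a \<in> ?I" "x \<in> carrier ?R" for a x
      using mem[OF that] by (simp_all add: monoid_ring_def mult.commute)
  qed (rule ring_axioms)
  moreover have "?S \<subseteq> ?I" by (auto simp: monoid_ring_def)
  ultimately show "tM_ideal M \<subseteq> ?I" unfolding tM_ideal_def genideal_def by blast
  have SR: "?S \<subseteq> carrier ?R" by (auto simp: monoid_ring_def)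
  have idl: "ideal (tM_ideal M) ?R" unfolding tM_ideal_def using SR by (rule genideal_ideal)
  show "?I \<subseteq> tM_ideal M"
  proof
    fix f assume f: "f \<in> ?I"
    have "Poly_Mapping.single a c \<in> tM_ideal M" if "a \<in> keys f" for a and c :: 'k
    proof -
      have a: "a \<in> M" "a \<noteq> 0" using that f by (auto simp: monoid_ring_def)
      then have S: "Poly_Mapping.single a (1 :: 'k) \<in> ?S" using Units_add_monoid_of[OF M] by auto
      have "Poly_Mapping.single a (1 :: 'k) \<in> tM_ideal M"
        unfolding tM_ideal_def by (rule subsetD[OF genideal_self[OF SR] S])
      moreover have "Poly_Mapping.single 0 c \<in> carrier ?R"
        using M(1) by (auto simp: monoid_ring_def is_submonoid_def)
      ultimately have "Poly_Mapping.single 0 c \<otimes>\<^bsub>?R\<^esub> Poly_Mapping.single a 1 \<in> tM_ideal M"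
        by (rule ideal.I_l_closed[OF idl])
      then show ?thesis by (simp add: monoid_ring_def mult_single)
    qed
    moreover have "(\<Sum>a\<in>S. g a) \<in> tM_ideal M"
      if "finite S" "\<And>a. a \<in> S \<Longrightarrow> g a \<in> tM_ideal M" for S and g :: "'g \<Rightarrow> 'g \<Rightarrow>\<^sub>0 'k"
      using that
    proof (induction S rule: finite_induct)
      case empty
      then show ?case
        using additive_subgroup.zero_closed[OF ideal.axioms(1)[OF idl]] by (simp add: monoid_ring_def)
    next
      case (insert a S)
      then show ?case
        using additive_subgroup.a_closed[OF ideal.axioms(1)[OF idl], of "g a" "sum g S"]
        by (simp add: monoid_ring_def)
    qed
    ultimately have "(\<Sum>a\<in>keys f. Poly_Mapping.single a (lookup f a)) \<in> tM_ideal M" by simp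
    moreover have "(\<Sum>a\<in>keys f. Poly_Mapping.single a (lookup f a)) = f"
      by (rule poly_mapping_eqI) (simp add: lookup_sum lookup_single when_def in_keys_iff)
    ultimately show "f \<in> tM_ideal M" by simp
  qed
qed

lemma local_monoid_ring_iff:
  fixes x :: "('g::linordered_ab_group_add \<Rightarrow>\<^sub>0 'k::field) fract"
  assumes "is_submonoid M" "positive M"
  shows "x \<in> local_monoid_ring M \<longleftrightarrow> (\<exists>f h. x = Fract f h \<and> keys f \<subseteq> M \<and> keys h \<subseteq> M \<and> 0 \<in> keys h)"
  unfolding local_monoid_ring_def tM_ideal_eq[OF assms] by (auto simp: monoid_ring_def)

lemma Min_keys_eq_0:
  assumes "positive M" "keys h \<subseteq> M" "0 \<in> keys h"
  shows "h \<noteq> 0" "Min (keys h) = 0"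
  using assms by (auto simp: positive_def intro!: Min_eqI)

lemma keys_power_ge:
  fixes g :: "'g::linordered_ab_group_add \<Rightarrow>\<^sub>0 'k::field"
  assumes "\<And>\<kappa>. \<kappa> \<in> keys g \<Longrightarrow> \<gamma> \<le> \<kappa>" "\<kappa> \<in> keys (g ^ n)"
  shows "nmult n \<gamma> \<le> \<kappa>"
  using assms(2)
proof (induction n arbitrary: \<kappa>)
  case (Suc n)
  then obtain u w where "u \<in> keys g" "w \<in> keys (g ^ n)" "\<kappa> = u + w" using keys_mult[of g "g ^ n"] by auto
  then show ?case using assms(1) Suc.IH by (auto simp: nmult_Suc intro!: add_mono)
qed (simp split: if_splits)

text \<open>A denominator with leading term \<open>1\<close>, say \<open>1 - g\<close>, can be replaced by \<open>1 - g\<^sup>n\<close>, whose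
  exponents lie in \<open>M\<close> for large \<open>n\<close>.\<close>

lemma large_value_in_local_monoid_ring:
  fixes x :: "('g::linordered_ab_group_add \<Rightarrow>\<^sub>0 'k::field) fract"
  assumes M: "is_submonoid M" "positive M"
    and large: "\<And>\<gamma>. \<alpha> < \<gamma> \<Longrightarrow> \<gamma> \<in> M" and arch: "\<And>\<gamma>. 0 < \<gamma> \<Longrightarrow> \<exists>n. \<alpha> < nmult n \<gamma>"
    and \<alpha>: "0 < \<alpha>" and x: "x \<noteq> 0" "\<alpha> < val x"
  shows "x \<in> local_monoid_ring M"
proof -
  obtain f0 h0 where x0: "x = Fract f0 h0" "f0 \<noteq> 0" "h0 \<noteq> 0" using Fract_nonzero_cases[OF x(1)] .
  define \<mu> where "\<mu> = Min (keys h0)"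
  have \<mu>: "\<mu> \<in> keys h0" unfolding \<mu>_def using x0(3) by (intro Min_in) auto
  \<comment> \<open>Dividing by the leading term makes the denominator 1 - g with positive exponents
    in g. These exponents may leave \<open>M\<close> until the fraction is expanded by
    \<open>q\<close>.\<close>
  define s where "s = Poly_Mapping.single (- \<mu>) (inverse (lookup h0 \<mu>))"
  have s: "s \<noteq> 0" using \<mu> by (simp add: s_def single_nonzero in_keys_iff)
  define f h where "f = s * f0" and "h = s * h0"
  define g where "g = 1 - h"
  have xfh: "x = Fract f h" "f \<noteq> 0" "h \<noteq> 0" using x0 s by (simp_all add: f_def h_def eq_fract mult_ac)
  have lookup_h: "lookup h 0 = 1"
    using \<mu> by (simp add: h_def s_def lookup_single_mult in_keys_iff)
  have keys_h: "0 \<le> \<kappa>" if "\<kappa> \<in> keys h" for \<kappa>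
  proof -
    have "\<kappa> + \<mu> \<in> keys h0"
      using that by (simp add: h_def s_def lookup_single_mult in_keys_iff)
    then have "\<mu> \<le> \<kappa> + \<mu>" unfolding \<mu>_def by (intro Min_le) auto
    then show ?thesis by simp
  qed
  have keys_g: "0 < \<kappa>" if "\<kappa> \<in> keys g" for \<kappa>
  proof -
    have "\<kappa> \<noteq> 0" using that lookup_h by (auto simp: g_def in_keys_iff lookup_minus)
    moreover have "\<kappa> \<in> keys (1 :: 'g \<Rightarrow>\<^sub>0 'k) \<union> keys h" using that keys_diff[of 1 h] unfolding g_def by blast
    then have "\<kappa> \<noteq> 0 \<longrightarrow> \<kappa> \<in> keys h" by auto
    ultimately show ?thesis using keys_h by fastforce
  qed
  have "0 \<in> keys h" using lookup_h by (simp add: in_keys_iff)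
  then have "Min (keys h) = 0" using keys_h by (intro Min_eqI) auto
  then have "val x = Min (keys f)" using xfh by (simp add: val_Fract)
  then have keys_f: "\<alpha> < \<kappa>" if "\<kappa> \<in> keys f" for \<kappa>
    using x(2) Min_le[OF finite_keys that] by (simp only: less_le_trans)
  \<comment> \<open>For g = 0 the minimum of the empty set is unspecified; \<alpha> is then a
    convenient positive value.\<close>
  define \<gamma> where "\<gamma> = (if g = 0 then \<alpha> else Min (keys g))"
  have "0 < \<gamma>" using \<alpha> keys_g Min_in[of "keys g"] by (auto simp: \<gamma>_def)
  then obtain n where n: "\<alpha> < nmult n \<gamma>" using arch by blast
  have ge: "\<gamma> \<le> \<kappa>" if "\<kappa> \<in> keys g" for \<kappa> using that by (auto simp: \<gamma>_def)
  have keys_gn: "\<alpha> < \<kappa>" if "\<kappa> \<in> keys (g ^ n)" for \<kappa>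
    using keys_power_ge[OF ge that] n by (rule less_le_trans[rotated])
  define q where "q = (\<Sum>i<n. g ^ i)"
  have hq: "h * q = 1 - g ^ n" unfolding q_def using one_diff_power_eq[of g n] by (simp add: g_def)
  have "0 \<notin> keys (g ^ n)" using keys_gn \<alpha> by (meson less_asym)
  then have 0: "0 \<in> keys (h * q)" unfolding hq by (simp add: in_keys_iff lookup_minus lookup_one)
  have hq_M: "keys (h * q) \<subseteq> M"
  proof
    fix \<kappa> assume "\<kappa> \<in> keys (h * q)"
    then have "\<kappa> \<in> keys (1 :: 'g \<Rightarrow>\<^sub>0 'k) \<union> keys (g ^ n)" using keys_diff[of 1 "g ^ n"] unfolding hq by blast
    then show "\<kappa> \<in> M" using large keys_gn M(1) by (auto simp: is_submonoid_def split: if_splits)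
  qed
  have keys_q: "0 \<le> \<kappa>" if \<kappa>: "\<kappa> \<in> keys q" for \<kappa>
  proof -
    have "keys (\<Sum>i<n. g ^ i) \<subseteq> (\<Union>i<n. keys (g ^ i))" by (rule keys_sum)
    then obtain i where "\<kappa> \<in> keys (g ^ i)" using \<kappa> unfolding q_def by blast
    from keys_power_ge[OF ge this] show ?thesis
      using nmult_nonneg[of \<gamma> i] \<open>0 < \<gamma>\<close> by (meson order_trans less_imp_le)
  qed
  have fq_M: "keys (f * q) \<subseteq> M"
  proof
    fix \<kappa> assume "\<kappa> \<in> keys (f * q)"
    then obtain u w where "u \<in> keys f" "w \<in> keys q" "\<kappa> = u + w" using keys_mult[of f q] by blast
    with add_less_le_mono[OF keys_f[of u] keys_q[of w]] have "\<alpha> < \<kappa>" by simp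
    then show "\<kappa> \<in> M" by (rule large)
  qed
  have "x = Fract (f * q) (h * q)"
  proof -
    have "h * q \<noteq> 0" using 0 by auto
    then have "q \<noteq> 0" by auto
    then show ?thesis using xfh by (simp add: eq_fract mult_ac)
  qed
  with 0 hq_M fq_M show ?thesis unfolding local_monoid_ring_iff[OF M] by blast
qed

section \<open>Polynomials with bounded values\<close>

context valued_field
begin

text \<open>The valuation ring, and with \<open>small\<close> its maximal ideal; 0 is listed
  separately because its value is arbitrary.\<close>

definition integral :: "'f \<Rightarrow> bool" where
  "integral x \<longleftrightarrow> x = 0 \<or> 0 \<le> val x"

definition small :: "'f \<Rightarrow> bool" where
  "small x \<longleftrightarrow> x = 0 \<or> 0 < val x"

lemma integral_add: "integral x \<Longrightarrow> integral y \<Longrightarrow> integral (x + y)"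
  using val_add[of x y] by (cases "x = 0 \<or> y = 0 \<or> x + y = 0") (auto simp: integral_def min_le_iff_disj)

lemma small_add: "small x \<Longrightarrow> small y \<Longrightarrow> small (x + y)"
  using val_add[of x y] by (cases "x = 0 \<or> y = 0 \<or> x + y = 0") (auto simp: small_def min_le_iff_disj)

lemma integral_mult: "integral x \<Longrightarrow> integral y \<Longrightarrow> integral (x * y)"
  by (cases "x = 0 \<or> y = 0") (auto simp: integral_def val_mult)

lemma small_mult: "small x \<Longrightarrow> integral y \<Longrightarrow> small (x * y)"
  by (cases "x = 0 \<or> y = 0") (auto simp: integral_def small_def val_mult add_pos_nonneg)

lemma small_integral: "small x \<Longrightarrow> integral x"
  by (auto simp: integral_def small_def)

lemma integral_poly:
  "(\<And>i. integral (coeff p i)) \<Longrightarrow> integral x \<Longrightarrow> integral (poly p x)"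
proof (induction p)
  case (pCons a p)
  have "integral a" "\<And>i. integral (coeff p i)"
    using pCons.prems(1)[of 0] pCons.prems(1)[of "Suc _"] by simp_all
  with pCons show ?case by (simp add: integral_add integral_mult)
qed (simp add: integral_def)

text \<open>Reduction modulo the maximal ideal commutes with evaluation, here without forming the
  residue field.\<close>

lemma small_poly_diff:
  assumes "\<And>i. integral (coeff p i)" "integral c" "small y"
  shows "small (poly p (c + y) - poly p c)"
  using assms
proof (induction p)
  case (pCons a p)
  have p: "integral (coeff p i)" for i using pCons.prems(1)[of "Suc i"] by simp
  have "poly (pCons a p) (c + y) - poly (pCons a p) c =
      (poly p (c + y) - poly p c) * c + y * poly p (c + y)"
    by (simp add: algebra_simps)
  moreover have "small ((poly p (c + y) - poly p c) * c)"
    by (intro small_mult pCons.IH p pCons.prems)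
  moreover have "small (y * poly p (c + y))"
    by (rule small_mult[OF pCons.prems(3) integral_poly[OF p integral_add[OF pCons.prems(2) small_integral[OF pCons.prems(3)]]]])
  ultimately show ?case by (simp add: small_add)
qed (simp add: small_def)

lemma val_add_small:
  assumes "x \<noteq> 0" "val x = 0" "small y"
  shows "x + y \<noteq> 0 \<and> val (x + y) = 0"
  using assms val_add_less[of x y] by (cases "y = 0") (auto simp: small_def)

text \<open>A polynomial without roots over the residue field has no cancellation at integral points;
  at the other points the leading term dominates.\<close>

lemma val_poly_rootfree:
  fixes \<iota> :: "'k::field \<Rightarrow> 'f"
  assumes hom: "\<iota> 0 = 0" "\<And>a b. \<iota> (a + b) = \<iota> a + \<iota> b" "\<And>a b. \<iota> (a * b) = \<iota> a * \<iota> b"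
    and unit: "\<And>c. c \<noteq> 0 \<Longrightarrow> \<iota> c \<noteq> 0 \<and> val (\<iota> c) = 0"
    and residue: "\<And>x. integral x \<Longrightarrow> \<exists>c. small (x - \<iota> c)"
    and p: "\<And>c. poly p c \<noteq> 0"
  shows "poly (map_poly \<iota> p) a \<noteq> 0 \<and>
    val (poly (map_poly \<iota> p) a) = (if a = 0 then 0 else min (nmult (degree p) (val a)) 0)"
proof -
  let ?h = "map_poly \<iota> p"
  have integral_\<iota>: "integral (\<iota> c)" for c
    using unit[of c] hom(1) by (cases "c = 0") (auto simp: integral_def)
  then have coeff: "integral (coeff ?h i)" for i by (simp add: coeff_map_poly hom(1))
  have eval: "poly ?h (\<iota> c) = \<iota> (poly p c)" for c
    by (induction p) (simp_all add: map_poly_pCons hom)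
  show ?thesis
  proof (cases "integral a")
    case True
    then obtain c where c: "small (a - \<iota> c)" using residue by blast
    have "small (poly ?h (\<iota> c + (a - \<iota> c)) - poly ?h (\<iota> c))"
      by (rule small_poly_diff[OF coeff integral_\<iota> c])
    then have "small (poly ?h a - \<iota> (poly p c))" by (simp add: eval)
    with val_add_small[of "\<iota> (poly p c)"] unit[OF p] have "poly ?h a \<noteq> 0 \<and> val (poly ?h a) = 0"
      by fastforce
    moreover have "min (nmult (degree p) (val a)) 0 = 0" if "a \<noteq> 0"
      using True that by (intro min_absorb2 nmult_nonneg) (simp add: integral_def)
    ultimately show ?thesis by simp
  next
    case False
    then have a: "a \<noteq> 0" "val a < 0" by (auto simp: integral_def not_le)
    have p0: "p \<noteq> 0" using p by auto
    have deg: "degree ?h = degree p" using unit by (intro degree_map_poly) blast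
    have lead: "\<iota> (lead_coeff p) \<noteq> 0 \<and> val (\<iota> (lead_coeff p)) = 0" using unit p0 by simp
    \<comment> \<open>Reversing the polynomial trades the large point for its small inverse; the
      constant term of the reversal is the leading coefficient, a unit.\<close>
    have "small (poly (reflect_poly ?h) (0 + inverse a) - poly (reflect_poly ?h) 0)"
      using coeff a by (intro small_poly_diff)
        (auto simp: coeff_reflect_poly small_def val_inverse integral_def)
    then have "small (poly (reflect_poly ?h) (inverse a) - \<iota> (lead_coeff p))"
      by (simp add: deg coeff_map_poly hom(1))
    with val_add_small[of "\<iota> (lead_coeff p)"] lead
    have "poly (reflect_poly ?h) (inverse a) \<noteq> 0 \<and> val (poly (reflect_poly ?h) (inverse a)) = 0"
      by fastforce
    moreover have "poly ?h a = a ^ degree p * poly (reflect_poly ?h) (inverse a)"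
      using a(1) poly_reflect_poly_nz[of "inverse a" ?h] by (simp add: deg power_inverse)
    ultimately have "poly ?h a \<noteq> 0 \<and> val (poly ?h a) = nmult (degree p) (val a)"
      using a(1) by (simp add: val_mult val_power)
    moreover have "nmult (degree p) (val a) \<le> 0" using nmult_mono[of "val a" 0 "degree p"] a by simp
    ultimately show ?thesis using a(1) by simp
  qed
qed

end

text \<open>The residue is the quotient of the coefficients of numerator and denominator at the
  lowest exponent of the denominator. It identifies the residue field with \<open>k\<close>.\<close>

lemma residue_exists:
  fixes x :: "('g::linordered_ab_group_add \<Rightarrow>\<^sub>0 'k::field) fract"
  assumes "val.integral x"
  shows "\<exists>c. val.small (x - Fract (Poly_Mapping.single 0 c) 1)"
proof (cases "x = 0")
  case True
  then have "val.small (x - Fract (Poly_Mapping.single 0 0) 1)"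
    by (simp add: val.small_def fract_collapse single_zero)
  then show ?thesis by blast
next
  case False
  then obtain f h where x: "x = Fract f h" "f \<noteq> 0" "h \<noteq> 0" using Fract_nonzero_cases by blast
  define \<mu> where "\<mu> = Min (keys h)"
  have \<mu>: "\<mu> \<in> keys h" unfolding \<mu>_def using x(3) by (intro Min_in) auto
  have "\<mu> \<le> Min (keys f)"
    using assms False x by (simp add: val.integral_def val_Fract \<mu>_def)
  then have f: "\<mu> \<le> \<kappa>" if "\<kappa> \<in> keys f" for \<kappa> using Min_le[OF finite_keys that] by (rule order_trans)
  have h: "\<mu> \<le> \<kappa>" if "\<kappa> \<in> keys h" for \<kappa> unfolding \<mu>_def using that by (intro Min_le) auto
  define c where "c = lookup f \<mu> / lookup h \<mu>"
  define r where "r = f - Poly_Mapping.single 0 c * h"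
  have lookup_r: "lookup r \<kappa> = lookup f \<kappa> - c * lookup h \<kappa>" for \<kappa>
    by (simp add: r_def lookup_minus lookup_single_mult)
  have r: "\<mu> < \<kappa>" if "\<kappa> \<in> keys r" for \<kappa>
  proof -
    have "lookup r \<mu> = 0" using \<mu> by (simp add: lookup_r c_def in_keys_iff)
    then have "\<kappa> \<noteq> \<mu>" using that by (auto simp: in_keys_iff)
    moreover have "\<kappa> \<in> keys f \<or> \<kappa> \<in> keys h" using that by (auto simp: in_keys_iff lookup_r)
    ultimately show ?thesis using f h by fastforce
  qed
  have xr: "x - Fract (Poly_Mapping.single 0 c) 1 = Fract r h"
    using x by (simp add: r_def mult.commute)
  have "val.small (Fract r h)"
  proof (cases "r = 0")
    case True
    then show ?thesis by (simp add: val.small_def fract_collapse)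
  next
    case False
    have "\<mu> < Min (keys r)" using r Min_in[OF finite_keys keys_nonempty[OF False]] by blast
    then show ?thesis using x(3) False by (simp add: val.small_def val_Fract \<mu>_def)
  qed
  then show ?thesis unfolding xr[symmetric] by blast
qed

text \<open>Over a field that is not algebraically closed, a rootfree polynomial of degree m gives
  \<delta> = 0. Otherwise some \<delta> is not an m-th multiple, and X^m - t with v(t) = \<delta>
  never has two terms of equal value.\<close>

lemma bounded_polynomial_exists:
  assumes "\<not> algebraically_closed_field TYPE('k::field) \<or> \<not> divisible_group (UNIV :: 'g::linordered_ab_group_add set)"
  shows "\<exists>(h :: ('g \<Rightarrow>\<^sub>0 'k) fract poly) m \<delta>. 0 < m \<and> (\<forall>a. poly h a \<noteq> 0 \<and>
    val (poly h a) = (if a = 0 then \<delta> else min (nmult m (val a)) \<delta>))"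
  using assms
proof
  assume "\<not> algebraically_closed_field TYPE('k)"
  then obtain p :: "'k poly" where p: "0 < degree p" "\<And>c. poly p c \<noteq> 0"
    by (auto simp: algebraically_closed_field_def)
  define \<iota> :: "'k \<Rightarrow> ('g \<Rightarrow>\<^sub>0 'k) fract" where "\<iota> c = Fract (Poly_Mapping.single 0 c) 1" for c
  have "\<iota> 0 = 0" by (simp add: \<iota>_def single_zero fract_collapse)
  moreover have "\<iota> (a + b) = \<iota> a + \<iota> b" for a b by (simp add: \<iota>_def single_add)
  moreover have "\<iota> (a * b) = \<iota> a * \<iota> b" for a b by (simp add: \<iota>_def mult_single)
  moreover have "\<iota> c \<noteq> 0 \<and> val (\<iota> c) = 0" if "c \<noteq> 0" for c
    using that by (simp add: \<iota>_def Fract_neq_0 single_nonzero val_Fract)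
  moreover have "\<exists>c. val.small (x - \<iota> c)" if "val.integral x" for x
    using residue_exists[OF that] by (simp add: \<iota>_def)
  ultimately have "poly (map_poly \<iota> p) a \<noteq> 0 \<and>
      val (poly (map_poly \<iota> p) a) = (if a = 0 then 0 else min (nmult (degree p) (val a)) 0)" for a
    using p(2) by (rule val.val_poly_rootfree)
  with p(1) show ?thesis by blast
next
  assume "\<not> divisible_group (UNIV :: 'g set)"
  then obtain \<delta> :: 'g and m where m: "1 \<le> m" "\<And>\<gamma>. nmult m \<gamma> \<noteq> \<delta>"
    by (auto simp: divisible_group_def)
  obtain t :: "('g \<Rightarrow>\<^sub>0 'k) fract" where t: "t \<noteq> 0" "val t = \<delta>" using val.val_surj by blast
  define h where "h = monom 1 m + [:- t:]"
  have h: "poly h a = a ^ m + - t" for a by (simp add: h_def poly_monom)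
  have "poly h a \<noteq> 0 \<and> val (poly h a) = (if a = 0 then \<delta> else min (nmult m (val a)) \<delta>)" for a
  proof (cases "a = 0")
    case True
    moreover have "0 < m" using m(1) by simp
    ultimately show ?thesis using t by (simp add: h val.val_minus zero_power)
  next
    case False
    with val.val_add_neq[of "a ^ m" "- t"] t m(2)[of "val a"] show ?thesis
      by (simp add: h val.val_minus val.val_power)
  qed
  with m(1) show ?thesis by (intro exI[of _ h] exI[of _ m] exI[of _ \<delta>]) simp
qed

section \<open>Bounded factorization monoids\<close>

lemma comm_monoid_cancel_add_monoid_of:
  fixes M :: "'g::linordered_ab_group_add set"
  assumes "is_submonoid M"
  shows "comm_monoid_cancel (add_monoid_of M)"
proof -
  interpret comm_monoid "add_monoid_of M"
    using assms by (intro comm_monoidI) (auto simp: is_submonoid_def add_monoid_of_def ac_simps)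
  show ?thesis by (intro comm_monoid_cancelI comm_monoid_axioms) (auto simp: add_monoid_of_def)
qed

text \<open>Nonzero summands refine into atoms without shortening the list, so the bound on lengths
  of factorizations covers all decompositions.\<close>

lemma bounded_factorization_sum_list:
  fixes M :: "'g::linordered_ab_group_add set"
  assumes M: "is_submonoid M" "positive M" and bf: "bounded_factorization (add_monoid_of M)"
    and \<mu>: "\<mu> \<in> M" "\<mu> \<noteq> 0"
  shows "\<exists>B. \<forall>xs. set xs \<subseteq> M - {0} \<longrightarrow> sum_list xs = \<mu> \<longrightarrow> length xs \<le> B"
proof -
  let ?G = "add_monoid_of M"
  interpret comm_monoid_cancel ?G using M(1) by (rule comm_monoid_cancel_add_monoid_of)
  have G: "carrier ?G = M" "Units ?G = {0}"
    using Units_add_monoid_of[OF M] by (simp_all add: add_monoid_of_def)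
  have sum: "foldr (mult ?G) xs (one ?G) = sum_list xs" for xs
    by (induction xs) (simp_all add: add_monoid_of_def)
  have fin: "finite (lengths ?G \<mu>)" using bf \<mu> by (simp add: bounded_factorization_def G)
  have "length xs \<le> Max (lengths ?G \<mu>)" if xs: "set xs \<subseteq> M - {0}" "sum_list xs = \<mu>" for xs
  proof -
    have "\<exists>fs. set fs \<subseteq> carrier ?G \<and> factors ?G fs x" if "x \<in> set xs" for x
      using bf xs(1) that unfolding bounded_factorization_def atomic_def G by blast
    then obtain fs where fs: "set fs \<subseteq> carrier ?G" "factors ?G fs \<mu>" "length xs \<le> length fs"
      using factors_refine[of xs] xs unfolding G sum by auto
    have "wfactors ?G fs \<mu>" using fs(2,1) by (rule factors_wfactors)
    then have "length fs \<in> lengths ?G \<mu>" using fs(1) unfolding lengths_def by blast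
    with fin fs(3) show ?thesis by (meson Max_ge order_trans)
  qed
  then show ?thesis by blast
qed

lemma sum_list_replicate_nmult: "sum_list (replicate n x) = nmult n x"
  by (induction n) (simp_all add: nmult_Suc)

text \<open>If some multiples of \<open>\<mu>\<close> could be split off from a fixed element, leaving a remainder above
  \<open>\<alpha>\<close>, then that element would have arbitrarily long factorizations.\<close>

lemma terminal_multiples_bounded:
  fixes M :: "'g::linordered_ab_group_add set"
  assumes M: "is_submonoid M" "positive M" and bf: "bounded_factorization (add_monoid_of M)"
    and large: "\<And>\<gamma>. \<alpha> < \<gamma> \<Longrightarrow> \<gamma> \<in> M" and "0 < \<alpha>" and "\<alpha> < \<delta>"
  shows "\<exists>n. \<forall>\<mu>\<in>M. 0 < \<mu> \<longrightarrow> \<delta> \<le> \<alpha> + nmult n \<mu>"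
proof -
  have "\<delta> \<noteq> 0" using assms(5,6) by order
  then obtain B where B: "\<And>xs. set xs \<subseteq> M - {0} \<Longrightarrow> sum_list xs = \<delta> \<Longrightarrow> length xs \<le> B"
    using bounded_factorization_sum_list[OF M bf large[OF assms(6)]] by blast
  have "\<delta> \<le> \<alpha> + nmult (Suc B) \<mu>" if \<mu>: "\<mu> \<in> M" "0 < \<mu>" for \<mu>
  proof (rule ccontr)
    assume "\<not> ?thesis"
    then have r: "\<alpha> < \<delta> - nmult (Suc B) \<mu>" by (simp add: algebra_simps)
    let ?xs = "(\<delta> - nmult (Suc B) \<mu>) # replicate (Suc B) \<mu>"
    have "sum_list ?xs = \<delta>"
      by (simp only: sum_list.Cons sum_list_replicate_nmult diff_add_cancel)
    moreover have "set ?xs \<subseteq> M - {0}" using large[OF r] r \<mu> assms(5) by auto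
    ultimately have "length ?xs \<le> B" by (rule B[rotated])
    then show False by simp
  qed
  then show ?thesis by blast
qed

section \<open>From the hypotheses on the monoid to the valued field\<close>

theorem theorem4p4:
  fixes M :: "'g::linordered_ab_group_add set"
    and \<alpha> \<beta> :: 'g
    and D :: "('g \<Rightarrow>\<^sub>0 'k::field) fract set"
    and v :: "('g \<Rightarrow>\<^sub>0 'k) fract \<Rightarrow> 'g"
    and d :: "('g \<Rightarrow>\<^sub>0 'k) fract"
    and N :: nat
  assumes "is_submonoid M" and "gp M = UNIV"
    and "integrally_terminal M" and "positive M"
    and "bounded_factorization (add_monoid_of M)"
    and "\<not> (\<exists>\<gamma>\<in>gp M. 0 < \<gamma> \<and> (\<forall>\<delta>\<in>gp M. 0 < \<delta> \<longrightarrow> \<gamma> \<le> \<delta>))"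
    and "\<alpha> \<in> M" and "integrally_terminal_for M \<alpha>"
    and "\<beta> \<in> gp M" and "0 < \<beta>" and "\<beta> < \<alpha>"
    and "\<not> (\<exists>\<gamma>\<in>M. \<beta> < \<gamma> \<and> \<gamma> < \<alpha>)"
    and "\<not> algebraically_closed_field TYPE('k) \<or> \<not> divisible_group (gp M)"
    and D: "D = local_monoid_ring M"
    and v: "v = M_valuation M"
    and "d \<in> D" and "d \<noteq> 0" and "d \<notin> Units (mult_monoid_of D)"
    and "v d > nmult 3 \<alpha>"
    and N: "N = (LEAST n. nmult n \<alpha> > v d)"
  shows "lengths (mult_monoid_of D) d \<union> {2..N - 2}
           \<subseteq> lengths (mult_monoid_of (IntR D)) (const_ratfun d)
       \<and> lengths (mult_monoid_of (IntR D)) (const_ratfun d)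
           \<subseteq> {n. 2 \<le> n \<and> enat n \<le> max_length (mult_monoid_of D) d}"
proof -
  note M = \<open>is_submonoid M\<close> \<open>positive M\<close>
  note bf = \<open>bounded_factorization (add_monoid_of M)\<close>
  have large: "\<gamma> \<in> M" if "\<alpha> < \<gamma>" for \<gamma>
    using assms(2,8) that by (simp add: integrally_terminal_for_def)
  have arch0: "\<exists>n. \<alpha> < nmult n \<gamma>" if "0 < \<gamma>" for \<gamma>
    using assms(2,8) that by (simp add: integrally_terminal_for_def)
  have \<alpha>: "0 < \<alpha>" using assms by order
  \<comment> \<open>Terminality only makes multiples pass \<alpha>; that multiples of \<alpha> pass
    everything comes from bounded factorization, and both together give the archimedean
    property.\<close>
  have arch_\<alpha>: "\<exists>n. \<delta> < nmult n \<alpha>" for \<delta>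
  proof (cases "\<alpha> < \<delta>")
    case True
    then obtain n where "\<delta> \<le> \<alpha> + nmult n \<alpha>"
      using terminal_multiples_bounded[OF M bf large \<alpha>] \<open>\<alpha> \<in> M\<close> \<alpha> by blast
    also have "\<dots> < nmult (Suc (Suc n)) \<alpha>" using \<alpha> by (simp add: nmult_Suc)
    finally show ?thesis by blast
  next
    case False
    then have "\<delta> < nmult 2 \<alpha>" using \<alpha> by (simp add: numeral_2_eq_2 nmult_Suc add_strict_increasing)
    then show ?thesis by blast
  qed
  interpret G: dense_archimedean "TYPE('g)"
  proof
    fix x y :: 'g assume x: "0 < x"
    obtain n where n: "\<alpha> < nmult n x" using arch0[OF x] by blast
    obtain k where "y < nmult k \<alpha>" using arch_\<alpha> by blast
    also have "\<dots> \<le> nmult (k * n) x" using n by (simp add: nmult_mult nmult_mono)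
    finally show "\<exists>n. y < nmult n x" by blast
    show "\<exists>y. 0 < y \<and> y < x" using assms(6) x unfolding \<open>gp M = UNIV\<close> by (meson UNIV_I not_le)
  qed
  \<comment> \<open>Applied to 2 \<alpha>, the bound says that n0-fold multiples of all positive
    elements of \<open>M\<close> reach \<alpha>. Any \<epsilon> with n0 \<epsilon> < \<alpha> then
    bounds them from below.\<close>
  obtain n0 where n0: "\<And>\<mu>. \<mu> \<in> M \<Longrightarrow> 0 < \<mu> \<Longrightarrow> \<alpha> + \<alpha> \<le> \<alpha> + nmult n0 \<mu>"
    using terminal_multiples_bounded[OF M bf large \<alpha>, of "\<alpha> + \<alpha>"] \<alpha> by auto
  obtain \<epsilon> where \<epsilon>: "0 < \<epsilon>" "nmult n0 \<epsilon> < \<alpha>" using G.small_multiple[OF \<alpha>] by blast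
  have gap: "\<mu> = 0 \<or> \<epsilon> \<le> \<mu>" if "\<mu> \<in> M" for \<mu>
  proof (rule ccontr)
    assume *: "\<not> ?thesis"
    then have "0 < \<mu>" using M(2) that unfolding positive_def by force
    with n0[OF that] have "\<alpha> \<le> nmult n0 \<mu>" by simp
    also have "\<dots> \<le> nmult n0 \<epsilon>" using * by (intro nmult_mono) auto
    finally show False using \<epsilon>(2) by simp
  qed
  obtain h :: "('g \<Rightarrow>\<^sub>0 'k) fract poly" and m and \<delta> :: 'g where h: "0 < m"
      "\<And>a. poly h a \<noteq> 0" "\<And>a. val (poly h a) = (if a = 0 then \<delta> else min (nmult m (val a)) \<delta>)"
    using bounded_polynomial_exists[where 'k = 'k and 'g = 'g] assms(13) unfolding \<open>gp M = UNIV\<close> by blast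
  have D_iff: "x \<in> D \<longleftrightarrow> (\<exists>f h. x = Fract f h \<and> keys f \<subseteq> M \<and> keys h \<subseteq> M \<and> 0 \<in> keys h)" for x
    unfolding D by (rule local_monoid_ring_iff[OF M])
  interpret bump_domain val D M \<epsilon> \<alpha> \<beta> \<delta> h m
  proof
    show "mult_submonoid D"
      unfolding mult_submonoid_def
    proof (intro conjI ballI)
      have "(1 :: ('g \<Rightarrow>\<^sub>0 'k) fract) = Fract 1 1" by (simp add: One_fract_def)
      then show "1 \<in> D" unfolding D_iff using M(1)
        by (intro exI[of _ 1]) (simp add: is_submonoid_def)
      fix x y assume "x \<in> D" "y \<in> D"
      then obtain f g f' g' where *: "x = Fract f g" "keys f \<subseteq> M" "keys g \<subseteq> M" "0 \<in> keys g"
          "y = Fract f' g'" "keys f' \<subseteq> M" "keys g' \<subseteq> M" "0 \<in> keys g'"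
        unfolding D_iff by blast
      \<comment> \<open>Minimal exponents add, so a product of denominators again has a nonzero
        constant term.\<close>
      have "g * g' \<noteq> 0" "Min (keys (g * g')) = 0"
        using Min_keys_eq_0[OF M(2) *(3,4)] Min_keys_eq_0[OF M(2) *(7,8)] by (simp_all add: Min_keys_mult)
      then have "0 \<in> keys (g * g')" by (metis Min_in finite_keys keys_nonempty)
      moreover have "x * y = Fract (f * f') (g * g')" using * by simp
      ultimately show "x * y \<in> D"
        unfolding D_iff using * keys_mult_submonoid[OF M(1)] by blast
    qed
  next
    fix x :: "('g \<Rightarrow>\<^sub>0 'k) fract" assume x: "x \<in> D" "x \<noteq> 0"
    then obtain f g where *: "x = Fract f g" "keys f \<subseteq> M" "keys g \<subseteq> M" "0 \<in> keys g"
      unfolding D_iff by blast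
    then have f: "f \<noteq> 0" using x(2) by (auto simp: fract_collapse)
    have val_x: "val x = Min (keys f)" using * f Min_keys_eq_0[OF M(2) *(3,4)] by (simp add: val_Fract)
    have Min_f: "Min (keys f) \<in> keys f" using f by (intro Min_in) auto
    with *(2) show "val x \<in> M" unfolding val_x by blast
    assume "val x = 0"
    with Min_f have "0 \<in> keys f" unfolding val_x by simp
    then show "inverse x \<in> D" unfolding D_iff using * by auto
  next
    show "x \<in> D" if "x \<noteq> 0" "\<alpha> < val x" for x
      unfolding D using large_value_in_local_monoid_ring[OF M large arch0 \<alpha> that] .
  qed (use assms gap \<epsilon> h in auto)
  have vd: "v d = val d" using M_valuation_eq_val[OF assms(1,2)] \<open>d \<noteq> 0\<close> v by blast
  have "lengths DM d \<subseteq> lengths RM (const_ratfun d)"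
    using lengths_D_subset \<open>d \<in> D\<close> \<open>d \<noteq> 0\<close> by blast
  moreover have "{2..N - 2} \<subseteq> lengths RM (const_ratfun d)"
  proof
    fix n assume n: "n \<in> {2..N - 2}"
    \<comment> \<open>From n \<le> N - 2 even n + 1 lies below the least index, which gives (n + 1)
      \<alpha> \<le> v(d), the budget required by the construction.\<close>
    then have "Suc n < N" by auto
    then have "\<not> val d < nmult (Suc n) \<alpha>" unfolding N vd using not_less_Least by blast
    with n show "n \<in> lengths RM (const_ratfun d)"
      using lengths_IntR_constructed[of n d] \<open>d \<noteq> 0\<close> by simp
  qed
  moreover have "lengths RM (const_ratfun d) \<subseteq> {n. 2 \<le> n \<and> enat n \<le> max_length DM d}"
  proof -
    have "\<alpha> + \<alpha> < nmult 3 \<alpha>" using \<alpha> by (simp add: numeral_3_eq_3 nmult_Suc)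
    also have "\<dots> < val d" using assms(19) unfolding vd .
    finally have "\<alpha> < val d - \<alpha>" by (simp add: algebra_simps)
    \<comment> \<open>A value for one factor of \<open>d\<close> that leaves more than \<alpha> for
      the other, so that both belong to \<open>D\<close>.\<close>
    then obtain \<gamma> where \<gamma>: "\<alpha> < \<gamma>" "\<gamma> < val d - \<alpha>" using G.dense by blast
    obtain c :: "('g \<Rightarrow>\<^sub>0 'k) fract" where c: "c \<noteq> 0" "val c = \<gamma>" using val.val_surj by blast
    then have "val (d / c) = val d - \<gamma>" using \<open>d \<noteq> 0\<close> by (simp add: val.val_divide)
    moreover have "\<alpha> < val d - \<gamma>" using \<gamma>(2) by (simp add: algebra_simps)
    ultimately have dc: "\<alpha> < val (d / c)" by simp
    have "d = c * (d / c)" "c \<in> D" "d / c \<in> D" "0 < val c" "0 < val (d / c)"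
      using c \<gamma> dc \<alpha> large_D[OF c(1)] large_D[of "d / c"] \<open>d \<noteq> 0\<close> by auto
    from lengths_IntR_bounds[OF this \<open>d \<noteq> 0\<close>] show ?thesis by blast
  qed
  ultimately show ?thesis by blast
qed

end
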